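(* Let $1\le p_1\le\infty$, $1/p_1^*=1-1/p_1$, let $X_k$ $(k\in\mathbb{N}_0)$ and $G$ be Banach spaces over $\mathbb{K}$, let $S_k\in L(X_k,G)$ be bounded linear operators, let $\emptyset\ne\Lambda_k\subseteq X_k^*$, and let $X$, $\Lambda$, $S$, $P_k$ be as defined in the context. Assume that $$\big\|(\|S_k\|)_{k=0}^\infty\big\|_{\ell_{p_1^*}}<\infty.$$ Let $\mathrm{set}\in\{\mathrm{det},\mathrm{det-non},\mathrm{ran},\mathrm{ran-non}\}$. Then for all $n,k\in\mathbb{N}_0$ $$e_n^{\mathrm{set}}(S_k,B_{X_k},G)\le e_n^{\mathrm{set}}(S,B_X,G).$$ Moreover, for $k_1\in\mathbb{N}_0$, $(n_k)_{k=0}^{k_1}\subset\mathbb{N}_0$, and $n=\sum_{k=0}^{k_1}n_k$, $$e_n^{\mathrm{set}}(S,B_X,G)\le\Big\|S-S\sum_{k=0}^{k_1}P_k\Big\|_{L(X,G)}+\sum_{k=0}^{k_1}e_{n_k}^{\mathrm{set}}(S_k,B_{X_k},G)\le\big\|(\|S_k\|)_{k=k_1+1}^\infty\big\|_{\ell_{p_1^*}}+\sum_{k=0}^{k_1}e_{n_k}^{\mathrm{set}}(S_k,B_{X_k},G).$$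
   Context: $\mathbb{N}=\{1,2,\dots\}$, $\mathbb{N}_0=\mathbb{N}\cup\{0\}$, $\mathbb{K}\in\{\mathbb{R},\mathbb{C}\}$, $1/\infty=0$, $B_X$ is the closed unit ball of a normed space $X$, $L(X,G)$ is the space of bounded linear operators, $X^*$ the dual space. Direct sums. $X=\big(\bigoplus_{k=0}^\infty X_k\big)_{p_1}$ is the space of sequences $x=(x_k)_{k=0}^\infty$, $x_k\in X_k$, with finite norm $\|x\|=\big\|(\|x_k\|_{X_k})_{k=0}^\infty\big\|_{\ell_{p_1}}$. $P_k:X\to X$ maps $(x_l)_{l=0}^\infty$ to the sequence whose $k$-th entry is $x_k$ and whose other entries are $0$. $\Lambda=\bigcup_{k=0}^\infty\Phi_k(\Lambda_k)$, where $\Phi_k:\Lambda_k\to X^*$, $(\Phi_k(\lambda_k))(x)=\lambda_k(x_k)$. $S:X\to G$, $S((x_k)_{k=0}^\infty)=\sum_{k=0}^\infty S_kx_k$. The minimal errors of $S_k$ refer to the problem $(B_{X_k},G,S_k,\mathbb{K},\Lambda_k)$, those of $S$ to $(B_X,G,S,\mathbb{K},\Lambda)$. Algorithms and minimal errors. A numerical problem is a tuple $(F,G,S,K,\Lambda)$: $F$ a nonempty set, $G$ a Banach space, $S:F\to G$ a map, $K$ a nonempty set, $\Lambda$ a nonempty set of maps $F\to K$. A deterministic algorithm is a tuple $A=((L_i)_{i\ge1},(\tau_i)_{i\ge0},(\varphi_i)_{i\ge0})$ with $L_1\in\Lambda$, $\tau_0\in\{0,1\}$, $\varphi_0\in G$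 and arbitrary maps $L_{i+1}:K^i\to\Lambda$, $\tau_i:K^i\to\{0,1\}$, $\varphi_i:K^i\to G$ $(i\ge1)$. For $f\in F$ let $\lambda_1=L_1$, $\lambda_i=L_i(\lambda_1(f),\dots,\lambda_{i-1}(f))$ $(i\ge2)$. $\mathrm{card}(A,f)$ is the smallest $n\ge0$ with $\tau_n(\lambda_1(f),\dots,\lambda_n(f))=1$ (for $n=0$: $\tau_0=1$), and $\infty$ if there is none. The output is $A(f)=\varphi_n(\lambda_1(f),\dots,\lambda_n(f))$ if $n=\mathrm{card}(A,f)<\infty$ (with $A(f)=\varphi_0$ for $n=0$) and $A(f)=\varphi_0$ if $\mathrm{card}(A,f)=\infty$. $A$ is non-adaptive if all $L_i$ and all $\tau_i$ are constant. For $n\in\mathbb{N}_0$, $e_n^{\mathrm{det}}(S,F,G)$ (resp. $e_n^{\mathrm{det-non}}(S,F,G)$) is the infimum of $\sup_{f\in F}\|S(f)-A(f)\|_G$ over all (resp. all non-adaptive) deterministic algorithms with $\sup_{f\in F}\mathrm{card}(A,f)\le n$. A randomized algorithm is $A=((\Omega,\Sigma,\mathbb{P}),(A_\omega)_{\omega\in\Omega})$ with $(\Omega,\Sigma,\mathbb{P})$ a probability space and each $A_\omega$ a deterministic algorithm, such that for every $f\in F$ the map $\omega\mapsto\mathrm{card}(A_\omega,f)$ is measurable and $\omega\mapsto A_\omega(f)$ is Borel measurable and almost surely separably valued; it is non-adaptive if every $A_\omega$ is. $e_n^{\mathrm{ran}}(S,F,G)$ (resp. $e_n^{\mathrm{ran-non}}(S,F,G)$)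 is the infimum of $\sup_{f\in F}\mathbb{E}\|S(f)-A_\omega(f)\|_G$ over all (resp. all non-adaptive) randomized algorithms with $\sup_{f\in F}\mathbb{E}\,\mathrm{card}(A_\omega,f)\le n$. *)

theory Defs
  imports "HOL-Probability.Probability" "HOL-Algebra.Module"
begin

section \<open>Scalars\<close>

text \<open>The scalar field is a type \<open>'k\<close> that is a copy of the reals or of the complex numbers; the
  axiom says that it embeds isometrically into \<^typ>\<open>complex\<close>, with range either the real line or
  everything.\<close>

class real_or_complex = real_normed_field +
  assumes real_or_complex:
    "\<exists>\<iota> :: 'a \<Rightarrow> complex. (\<forall>a b. \<iota> (a + b) = \<iota> a + \<iota> b \<and> \<iota> (a * b) = \<iota> a * \<iota> b) \<and>
       (\<forall>a. cmod (\<iota> a) = norm a) \<and> range \<iota> \<in> {\<real>, UNIV}"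

instance real :: real_or_complex
  by standard (rule exI[of _ complex_of_real], auto simp: Reals_def)

instance complex :: real_or_complex
  by standard (rule exI[of _ id], auto)

definition scalars :: "'k::real_or_complex ring" where
  "scalars = \<lparr>carrier = UNIV, mult = (*), one = 1, zero = 0, add = (+)\<rparr>"


section \<open>Banach spaces and bounded operators\<close>

text \<open>A sequence of Banach spaces over a common field is a function from \<^typ>\<open>nat\<close> into the following
  record type, so all the spaces have carriers in one type \<open>'a\<close> but are otherwise unrelated: carrier,
  vector space operations and norm are free for every index.  The fields \<^const>\<open>mult\<close> and
  \<^const>\<open>one\<close>, which the module records of the library inherit from rings, have no meaning here.\<close>

record ('k, 'a) normed_module = "('k, 'a) module" +
  nrm :: "'a \<Rightarrow> real"

definition banach_space :: "('k::real_or_complex, 'a) normed_module \<Rightarrow> bool" where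
  "banach_space X \<longleftrightarrow>
     Module.module scalars X \<and>
     (\<forall>x\<in>carrier X. 0 \<le> nrm X x \<and> (nrm X x = 0 \<longleftrightarrow> x = \<zero>\<^bsub>X\<^esub>)) \<and>
     (\<forall>c. \<forall>x\<in>carrier X. nrm X (c \<odot>\<^bsub>X\<^esub> x) = norm c * nrm X x) \<and>
     (\<forall>x\<in>carrier X. \<forall>y\<in>carrier X. nrm X (x \<oplus>\<^bsub>X\<^esub> y) \<le> nrm X x + nrm X y) \<and>
     Metric_space.mcomplete (carrier X) (\<lambda>x y. nrm X (x \<ominus>\<^bsub>X\<^esub> y))"

definition unit_ball :: "('k, 'a) normed_module \<Rightarrow> 'a set" where
  "unit_ball X = {x \<in> carrier X. nrm X x \<le> 1}"

text \<open>The target space \<open>G\<close> is a type of class \<^class>\<open>banach\<close>, so that its Borel sets and limits are those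
  of the library, together with a multiplication by the scalars from \<open>'k\<close>.\<close>

definition scalar_multiplication :: "('k::real_or_complex \<Rightarrow> 'g::banach \<Rightarrow> 'g) \<Rightarrow> bool" where
  "scalar_multiplication scaleG \<longleftrightarrow>
     vector_space scaleG \<and> (\<forall>c y. norm (scaleG c y) = norm c * norm y)"

text \<open>Operators and functionals on a space are functions on the whole type \<open>'a\<close>; their values outside
  the carrier are irrelevant throughout.\<close>

definition bounded_ops ::
    "('k, 'a) normed_module \<Rightarrow> ('k \<Rightarrow> 'g \<Rightarrow> 'g) \<Rightarrow> ('a \<Rightarrow> 'g::real_normed_vector) set" where
  "bounded_ops X scaleG = {T.
     (\<forall>x\<in>carrier X. \<forall>y\<in>carrier X. T (x \<oplus>\<^bsub>X\<^esub> y) = T x + T y) \<and>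
     (\<forall>c. \<forall>x\<in>carrier X. T (c \<odot>\<^bsub>X\<^esub> x) = scaleG c (T x)) \<and>
     (\<exists>C. \<forall>x\<in>carrier X. norm (T x) \<le> C * nrm X x)}"

definition dual_space :: "('k::real_or_complex, 'a) normed_module \<Rightarrow> ('a \<Rightarrow> 'k) set" where
  "dual_space X = bounded_ops X (*)"

definition op_norm :: "('k, 'a) normed_module \<Rightarrow> ('a \<Rightarrow> 'g::real_normed_vector) \<Rightarrow> ennreal" where
  "op_norm X T = (SUP x\<in>unit_ball X. ennreal (norm (T x)))"


section \<open>Sequence norms and direct sums\<close>

definition ennpowr :: "ennreal \<Rightarrow> real \<Rightarrow> ennreal" where
  "ennpowr a r = (if a = \<top> then \<top> else ennreal (enn2real a powr r))"

definition lp_norm :: "ennreal \<Rightarrow> (nat \<Rightarrow> ennreal) \<Rightarrow> ennreal" where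
  "lp_norm p a =
     (if p = \<top> then (SUP k. a k)
      else ennpowr (\<Sum>k. ennpowr (a k) (enn2real p)) (1 / enn2real p))"

definition direct_sum ::
    "ennreal \<Rightarrow> (nat \<Rightarrow> ('k, 'a) normed_module) \<Rightarrow> ('k, nat \<Rightarrow> 'a) normed_module" where
  "direct_sum p X = \<lparr>
     carrier = {x. (\<forall>k. x k \<in> carrier (X k)) \<and> lp_norm p (\<lambda>k. ennreal (nrm (X k) (x k))) < \<top>},
     mult = undefined,
     one = undefined,
     zero = (\<lambda>k. \<zero>\<^bsub>X k\<^esub>),
     add = (\<lambda>x y k. x k \<oplus>\<^bsub>X k\<^esub> y k),
     smult = (\<lambda>c x k. c \<odot>\<^bsub>X k\<^esub> x k),
     nrm = (\<lambda>x. enn2real (lp_norm p (\<lambda>k. ennreal (nrm (X k) (x k)))))\<rparr>"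

definition coord_proj ::
    "(nat \<Rightarrow> ('k, 'a) normed_module) \<Rightarrow> nat \<Rightarrow> (nat \<Rightarrow> 'a) \<Rightarrow> (nat \<Rightarrow> 'a)" where
  "coord_proj X k x = (\<lambda>l. if l = k then x k else \<zero>\<^bsub>X l\<^esub>)"

definition sum_functionals :: "(nat \<Rightarrow> ('a \<Rightarrow> 'k) set) \<Rightarrow> ((nat \<Rightarrow> 'a) \<Rightarrow> 'k) set" where
  "sum_functionals \<Lambda> = (\<Union>k. (\<lambda>l x. l (x k)) ` \<Lambda> k)"

definition sum_operator :: "(nat \<Rightarrow> 'a \<Rightarrow> 'g::banach) \<Rightarrow> (nat \<Rightarrow> 'a) \<Rightarrow> 'g" where
  "sum_operator S x = (\<Sum>k. S k (x k))"


section \<open>Deterministic algorithms\<close>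

text \<open>The maps with index \<open>i\<close> of an algorithm are applied to lists of length \<open>i\<close>: \<open>query A ys\<close> is
  $L_{i+1}(ys)$, \<open>stop A ys\<close> is $\tau_i(ys) = 1$ and \<open>out A ys\<close> is $\varphi_i(ys)$ for \<open>i = length ys\<close>.
  The empty list gives $L_1$, $\tau_0$ and $\varphi_0$.\<close>

datatype ('f, 'k, 'g) algorithm = Algorithm
  (query: "'k list \<Rightarrow> 'f \<Rightarrow> 'k")
  (stop: "'k list \<Rightarrow> bool")
  (out: "'k list \<Rightarrow> 'g")

definition algorithms :: "('f \<Rightarrow> 'k) set \<Rightarrow> ('f, 'k, 'g) algorithm set" where
  "algorithms \<Lambda> = {A. \<forall>ys. query A ys \<in> \<Lambda>}"

definition non_adaptive :: "('f, 'k, 'g) algorithm \<Rightarrow> bool" where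
  "non_adaptive A \<longleftrightarrow>
     (\<forall>ys zs. length ys = length zs \<longrightarrow> query A ys = query A zs \<and> stop A ys = stop A zs)"

primrec info :: "('f, 'k, 'g) algorithm \<Rightarrow> 'f \<Rightarrow> nat \<Rightarrow> 'k list" where
  "info A f 0 = []"
| "info A f (Suc i) = info A f i @ [query A (info A f i) f]"

definition cost :: "('f, 'k, 'g) algorithm \<Rightarrow> 'f \<Rightarrow> enat" where
  "cost A f = (if \<exists>n. stop A (info A f n) then enat (LEAST n. stop A (info A f n)) else \<infinity>)"

definition result :: "('f, 'k, 'g) algorithm \<Rightarrow> 'f \<Rightarrow> 'g" where
  "result A f = (case cost A f of enat n \<Rightarrow> out A (info A f n) | \<infinity> \<Rightarrow> out A [])"

definition det_cost :: "'f set \<Rightarrow> ('f, 'k, 'g) algorithm \<Rightarrow> enat" where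
  "det_cost F A = (SUP f\<in>F. cost A f)"

definition det_error ::
    "('f \<Rightarrow> 'g) \<Rightarrow> 'f set \<Rightarrow> ('f, 'k, 'g::real_normed_vector) algorithm \<Rightarrow> ennreal" where
  "det_error S F A = (SUP f\<in>F. ennreal (norm (S f - result A f)))"


section \<open>Randomized algorithms\<close>

text \<open>Almost surely separably valued: almost surely the values lie in the closure of a countable
  set.\<close>

definition randomized_algorithm ::
    "'f set \<Rightarrow> ('f \<Rightarrow> 'k) set \<Rightarrow> 'w measure \<Rightarrow> ('w \<Rightarrow> ('f, 'k, 'g::banach) algorithm) \<Rightarrow> bool" where
  "randomized_algorithm F \<Lambda> M A \<longleftrightarrow>
     prob_space M \<and>
     (\<forall>\<omega>\<in>space M. A \<omega> \<in> algorithms \<Lambda>) \<and>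
     (\<forall>f\<in>F. (\<lambda>\<omega>. cost (A \<omega>) f) \<in> measurable M (count_space UNIV) \<and>
            (\<lambda>\<omega>. result (A \<omega>) f) \<in> borel_measurable M \<and>
            (\<exists>D. countable D \<and> (AE \<omega> in M. result (A \<omega>) f \<in> closure D)))"

definition ran_cost :: "'f set \<Rightarrow> 'w measure \<Rightarrow> ('w \<Rightarrow> ('f, 'k, 'g) algorithm) \<Rightarrow> ennreal" where
  "ran_cost F M A = (SUP f\<in>F. \<integral>\<^sup>+\<omega>. ennreal_of_enat (cost (A \<omega>) f) \<partial>M)"

definition ran_error ::
    "('f \<Rightarrow> 'g) \<Rightarrow> 'f set \<Rightarrow> 'w measure \<Rightarrow> ('w \<Rightarrow> ('f, 'k, 'g::banach) algorithm) \<Rightarrow> ennreal" where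
  "ran_error S F M A = (SUP f\<in>F. \<integral>\<^sup>+\<omega>. ennreal (norm (S f - result (A \<omega>) f)) \<partial>M)"


section \<open>Minimal errors\<close>

datatype setting = Det | DetNon | Ran | RanNon

text \<open>A definition cannot quantify over all types, so in the randomized settings the infimum is taken
  over the probability spaces whose points are of the type of deterministic algorithms.  This is the
  same as the infimum over all probability spaces: see \<open>min_error_Ran_le\<close> and
  \<open>min_error_RanNon_le\<close> below, where the type of the points is arbitrary.\<close>

fun min_error ::
    "setting \<Rightarrow> nat \<Rightarrow> ('f \<Rightarrow> 'g::banach) \<Rightarrow> 'f set \<Rightarrow> ('f \<Rightarrow> 'k) set \<Rightarrow> ennreal" where
  "min_error Det n S F \<Lambda> =
     Inf {det_error S F A | A. A \<in> algorithms \<Lambda> \<and> det_cost F A \<le> enat n}"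
| "min_error DetNon n S F \<Lambda> =
     Inf {det_error S F A | A. A \<in> algorithms \<Lambda> \<and> non_adaptive A \<and> det_cost F A \<le> enat n}"
| "min_error Ran n S F \<Lambda> =
     Inf {ran_error S F M A | (M :: ('f, 'k, 'g) algorithm measure) A.
       randomized_algorithm F \<Lambda> M A \<and> ran_cost F M A \<le> of_nat n}"
| "min_error RanNon n S F \<Lambda> =
     Inf {ran_error S F M A | (M :: ('f, 'k, 'g) algorithm measure) A.
       randomized_algorithm F \<Lambda> M A \<and> (\<forall>\<omega>\<in>space M. non_adaptive (A \<omega>)) \<and>
       ran_cost F M A \<le> of_nat n}"

text \<open>The image of a probability space under \<open>\<omega> \<mapsto> A \<omega>\<close>, with the final sigma-algebra.\<close>

lemma randomized_algorithm_image:
  fixes M :: "'w measure" and A :: "'w \<Rightarrow> ('f, 'k, 'g::banach) algorithm"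
  assumes ran: "randomized_algorithm F \<Lambda> M A"
  shows "\<exists>N :: ('f, 'k, 'g) algorithm measure.
    space N = A ` space M \<and> randomized_algorithm F \<Lambda> N id \<and>
    ran_cost F N id = ran_cost F M A \<and> (\<forall>S. ran_error S F N id = ran_error S F M A)"
proof -
  interpret prob_space M
    using ran by (simp add: randomized_algorithm_def)
  define \<A> where "\<A> = {B. B \<subseteq> A ` space M \<and> A -` B \<inter> space M \<in> sets M}"
  have sa: "sigma_algebra (A ` space M) \<A>"
  proof (rule sigma_algebra_iff2[THEN iffD2], intro conjI ballI allI impI)
    show "\<A> \<subseteq> Pow (A ` space M)" by (auto simp: \<A>_def)
    show "{} \<in> \<A>" by (auto simp: \<A>_def)
  next
    fix B assume B: "B \<in> \<A>"
    have "A -` (A ` space M - B) \<inter> space M = space M - (A -` B \<inter> space M)" by auto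
    also have "\<dots> \<in> sets M" using B by (auto simp: \<A>_def)
    finally show "A ` space M - B \<in> \<A>" by (auto simp: \<A>_def)
  next
    fix C :: "nat \<Rightarrow> ('f, 'k, 'g) algorithm set" assume C: "range C \<subseteq> \<A>"
    have "A -` (\<Union>i. C i) \<inter> space M = (\<Union>i. A -` C i \<inter> space M)" by auto
    also have "\<dots> \<in> sets M" using C by (intro sets.countable_UN) (auto simp: \<A>_def)
    finally show "(\<Union>i. C i) \<in> \<A>" using C by (auto simp: \<A>_def)
  qed
  define Q where "Q = sigma (A ` space M) \<A>"
  have sub: "\<A> \<subseteq> Pow (A ` space M)" by (auto simp: \<A>_def)
  have Q: "space Q = A ` space M" "sets Q = \<A>"
    unfolding Q_def using sub sigma_algebra.sets_measure_of_eq[OF sa] by (auto simp: space_measure_of_conv)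
  have AQ: "A \<in> measurable M Q"
    by (rule measurableI) (auto simp: Q \<A>_def)
  define N where "N = distr M Q A"
  have N: "space N = A ` space M" "sets N = \<A>" by (auto simp: N_def Q)
  have lift: "h \<in> measurable Q R" if "(\<lambda>\<omega>. h (A \<omega>)) \<in> measurable M R" for h and R :: "'z measure"
  proof (rule measurableI)
    show "h x \<in> space R" if "x \<in> space Q" for x
      using that measurable_space[OF \<open>(\<lambda>\<omega>. h (A \<omega>)) \<in> measurable M R\<close>] by (auto simp: Q)
  next
    fix B assume "B \<in> sets R"
    from measurable_sets[OF that this]
    have "(\<lambda>\<omega>. h (A \<omega>)) -` B \<inter> space M \<in> sets M" .
    also have "(\<lambda>\<omega>. h (A \<omega>)) -` B \<inter> space M = A -` (h -` B \<inter> space Q) \<inter> space M"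
      by (auto simp: Q)
    finally show "h -` B \<inter> space Q \<in> sets Q" by (auto simp: Q \<A>_def)
  qed
  have meas: "(\<lambda>a. cost a f) \<in> measurable Q (count_space UNIV)"
      "(\<lambda>a. result a f) \<in> borel_measurable Q" if "f \<in> F" for f
    using ran that by (auto intro!: lift simp: randomized_algorithm_def)
  have ae: "\<exists>D. countable D \<and> (AE a in N. result a f \<in> closure D)" if f: "f \<in> F" for f
  proof -
    obtain D where D: "countable D" "AE \<omega> in M. result (A \<omega>) f \<in> closure D"
      using ran f by (auto simp: randomized_algorithm_def)
    have "{a \<in> space Q. result a f \<in> closure D} = (\<lambda>a. result a f) -` closure D \<inter> space Q"
      by auto
    also have "\<dots> \<in> sets Q" by (rule measurable_sets[OF meas(2)[OF f]]) simp
    finally have "AE a in N. result a f \<in> closure D"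
      unfolding N_def using D(2) by (subst AE_distr_iff[OF AQ])
    then show ?thesis using D(1) by blast
  qed
  have "randomized_algorithm F \<Lambda> N id"
    unfolding randomized_algorithm_def
  proof (intro conjI ballI)
    show "prob_space N" unfolding N_def by (rule prob_space_distr[OF AQ])
    show "id \<omega> \<in> algorithms \<Lambda>" if "\<omega> \<in> space N" for \<omega>
      using that ran by (auto simp: N randomized_algorithm_def)
    fix f assume f: "f \<in> F"
    show "(\<lambda>\<omega>. cost (id \<omega>) f) \<in> measurable N (count_space UNIV)"
      "(\<lambda>\<omega>. result (id \<omega>) f) \<in> borel_measurable N"
      "\<exists>D. countable D \<and> (AE \<omega> in N. result (id \<omega>) f \<in> closure D)"
      using meas[OF f] ae[OF f] by (simp_all add: N_def)
  qed
  moreover have "ran_cost F N id = ran_cost F M A"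
    unfolding ran_cost_def
  proof (rule SUP_cong[OF refl])
    fix f assume f: "f \<in> F"
    have "(\<lambda>a. ennreal_of_enat (cost a f)) \<in> borel_measurable Q"
      by (rule measurable_compose[OF meas(1)[OF f]]) simp
    then show "(\<integral>\<^sup>+\<omega>. ennreal_of_enat (cost (id \<omega>) f) \<partial>N)
        = (\<integral>\<^sup>+\<omega>. ennreal_of_enat (cost (A \<omega>) f) \<partial>M)"
      unfolding N_def by (simp add: nn_integral_distr[OF AQ])
  qed
  moreover have "ran_error S F N id = ran_error S F M A" for S
    unfolding ran_error_def
  proof (rule SUP_cong[OF refl])
    fix f assume f: "f \<in> F"
    have "(\<lambda>y. ennreal (norm (S f - y))) \<in> borel_measurable borel"
      by (intro measurable_compose[OF _ measurable_ennreal] borel_measurable_continuous_onI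
          continuous_intros)
    from measurable_compose[OF meas(2)[OF f] this]
    show "(\<integral>\<^sup>+\<omega>. ennreal (norm (S f - result (id \<omega>) f)) \<partial>N)
        = (\<integral>\<^sup>+\<omega>. ennreal (norm (S f - result (A \<omega>) f)) \<partial>M)"
      unfolding N_def by (simp add: nn_integral_distr[OF AQ])
  qed
  ultimately show ?thesis using N(1) by blast
qed

lemma min_error_Ran_le:
  fixes M :: "'w measure"
  assumes "randomized_algorithm F \<Lambda> M A" "ran_cost F M A \<le> of_nat n"
  shows "min_error Ran n S F \<Lambda> \<le> ran_error S F M A"
proof -
  obtain N where N: "space N = A ` space M" "randomized_algorithm F \<Lambda> N id"
    "ran_cost F N id = ran_cost F M A" "ran_error S F N id = ran_error S F M A"
    using randomized_algorithm_image[OF assms(1)] by blast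
  show ?thesis
    unfolding min_error.simps
    by (rule Inf_lower, intro CollectI exI[of _ N] exI[of _ id] conjI)
      (use N(2-4) assms(2) in simp_all)
qed

lemma min_error_RanNon_le:
  fixes M :: "'w measure"
  assumes "randomized_algorithm F \<Lambda> M A" "\<forall>\<omega>\<in>space M. non_adaptive (A \<omega>)"
    "ran_cost F M A \<le> of_nat n"
  shows "min_error RanNon n S F \<Lambda> \<le> ran_error S F M A"
proof -
  obtain N where N: "space N = A ` space M" "randomized_algorithm F \<Lambda> N id"
    "ran_cost F N id = ran_cost F M A" "ran_error S F N id = ran_error S F M A"
    using randomized_algorithm_image[OF assms(1)] by blast
  have na: "\<forall>\<omega>\<in>space N. non_adaptive (id \<omega>)" using assms(2) N(1) by auto
  show ?thesis
    unfolding min_error.simps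
    by (rule Inf_lower, intro CollectI exI[of _ N] exI[of _ id] conjI)
      (use na N(2-4) assms(3) in simp_all)
qed

end

theory Submission
  imports Defs
begin

text \<open>
  Both parts of the theorem turn algorithms for one problem into algorithms for another.  If a map
  \<open>J\<close> carries the inputs of a problem into the inputs of a second one, carries solutions to
  solutions, and lets every functional of the second problem be evaluated at \<open>J e\<close> from one
  functional value at \<open>e\<close>, then each algorithm for the second problem can be simulated on \<open>J e\<close> at
  the same cost (\<open>min_error_pullback\<close>).  This holds in all four settings at once, because the
  simulation has the very same cost and output.

  For the lower bound, \<open>J\<close> embeds the unit ball of a summand in the unit ball of the direct sum.
  A functional that looks at another coordinate has the known value \<open>0\<close> on the image of \<open>J\<close>, so an
  algorithm for the sum operator becomes one for the summand (\<open>min_error_summand_le\<close>).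

  For the upper bound, the minimal errors are subadditive in operator and budget together
  (\<open>min_error_add\<close>): run one algorithm, then the other, and add the outputs.  In the randomized
  settings the two runs are independent, that is, they live on a product space.  In a non-separable
  Banach space the sum of two measurable maps may fail to be measurable; it is measurable on the
  completed product because both summands are almost surely separably valued.  With the projections
  to the coordinates in the role of \<open>J\<close>, this bounds the error for the partial sum
  \<open>\<Sum>k\<le>K. S k (x k)\<close> (\<open>min_error_partial_sum_le\<close>).  Replacing the partial sum by the full operator
  costs at most the norm of the difference (\<open>min_error_perturb\<close>), and that norm is bounded by
  Hoelder's inequality applied to the tail of the series (\<open>norm_tail_le\<close>).
\<close>

section \<open>Information and cost\<close>

lemma length_info [simp]: "length (info A f n) = n"
  by (induction n) auto

lemma take_info: "i \<le> n \<Longrightarrow> take i (info A f n) = info A f i"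
  by (induction n) (auto simp: le_Suc_eq)

lemma cost_eq_enat_iff:
  "cost A f = enat n \<longleftrightarrow> stop A (info A f n) \<and> (\<forall>i<n. \<not> stop A (info A f i))"
proof
  assume "cost A f = enat n"
  then show "stop A (info A f n) \<and> (\<forall>i<n. \<not> stop A (info A f i))"
    by (auto simp: cost_def split: if_splits intro: LeastI dest: not_less_Least)
next
  assume n: "stop A (info A f n) \<and> (\<forall>i<n. \<not> stop A (info A f i))"
  then have "(LEAST n. stop A (info A f n)) = n"
    by (intro Least_equality) (auto simp: not_less[symmetric])
  with n show "cost A f = enat n" by (auto simp: cost_def)
qed

lemma cost_eq_infinity_iff: "cost A f = \<infinity> \<longleftrightarrow> (\<forall>n. \<not> stop A (info A f n))"
  by (auto simp: cost_def)

section \<open>Simulating an algorithm along a map of inputs\<close>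

text \<open>Turns the answers received in the simulation into the answers that the simulated algorithm
  \<open>A\<close> would have received: \<open>\<gamma> l\<close> converts an answer to the query that replaces \<open>l\<close>.  Which \<open>l\<close> was
  asked depends on the answers translated so far, hence the fold.\<close>
definition translate ::
    "(('f \<Rightarrow> 'k) \<Rightarrow> 'k \<Rightarrow> 'k) \<Rightarrow> ('f, 'k, 'g) algorithm \<Rightarrow> 'k list \<Rightarrow> 'k list" where
  "translate \<gamma> A ys = foldl (\<lambda>zs y. zs @ [\<gamma> (query A zs) y]) [] ys"

lemma translate_simps [simp]:
  "translate \<gamma> A [] = []"
  "translate \<gamma> A (ys @ [y]) = translate \<gamma> A ys @ [\<gamma> (query A (translate \<gamma> A ys)) y]"
  by (simp_all add: translate_def)

lemma length_translate [simp]: "length (translate \<gamma> A ys) = length ys"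
  by (induction ys rule: rev_induct) auto

definition pullback ::
    "(('f \<Rightarrow> 'k) \<Rightarrow> 'e \<Rightarrow> 'k) \<Rightarrow> (('f \<Rightarrow> 'k) \<Rightarrow> 'k \<Rightarrow> 'k) \<Rightarrow> ('f, 'k, 'g) algorithm \<Rightarrow>
      ('e, 'k, 'g) algorithm" where
  "pullback \<phi> \<gamma> A = Algorithm
     (\<lambda>ys. \<phi> (query A (translate \<gamma> A ys)))
     (\<lambda>ys. stop A (translate \<gamma> A ys))
     (\<lambda>ys. out A (translate \<gamma> A ys))"

lemma pullback_sel [simp]:
  "query (pullback \<phi> \<gamma> A) ys = \<phi> (query A (translate \<gamma> A ys))"
  "stop (pullback \<phi> \<gamma> A) ys = stop A (translate \<gamma> A ys)"
  "out (pullback \<phi> \<gamma> A) ys = out A (translate \<gamma> A ys)"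
  by (simp_all add: pullback_def)

lemma non_adaptive_pullback: "non_adaptive A \<Longrightarrow> non_adaptive (pullback \<phi> \<gamma> A)"
  unfolding non_adaptive_def pullback_def by (metis algorithm.sel(1,2) length_translate)

lemma pullback_in_algorithms:
  "A \<in> algorithms \<Lambda>' \<Longrightarrow> (\<And>l. l \<in> \<Lambda>' \<Longrightarrow> \<phi> l \<in> \<Lambda>) \<Longrightarrow> pullback \<phi> \<gamma> A \<in> algorithms \<Lambda>"
  by (auto simp: algorithms_def pullback_def)

lemma translate_info_pullback:
  assumes "A \<in> algorithms \<Lambda>'" and "\<And>l. l \<in> \<Lambda>' \<Longrightarrow> l f = \<gamma> l (\<phi> l e)"
  shows "translate \<gamma> A (info (pullback \<phi> \<gamma> A) e n) = info A f n"
  using assms by (induction n) (auto simp: pullback_def algorithms_def)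

lemma cost_pullback:
  assumes "A \<in> algorithms \<Lambda>'" and "\<And>l. l \<in> \<Lambda>' \<Longrightarrow> l f = \<gamma> l (\<phi> l e)"
  shows "cost (pullback \<phi> \<gamma> A) e = cost A f"
proof -
  have "translate \<gamma> A (info (pullback \<phi> \<gamma> A) e n) = info A f n" for n
    using assms by (rule translate_info_pullback)
  then show ?thesis by (simp add: cost_def)
qed

lemma result_pullback:
  assumes "A \<in> algorithms \<Lambda>'" and "\<And>l. l \<in> \<Lambda>' \<Longrightarrow> l f = \<gamma> l (\<phi> l e)"
  shows "result (pullback \<phi> \<gamma> A) e = result A f"
proof -
  have "translate \<gamma> A (info (pullback \<phi> \<gamma> A) e n) = info A f n" for n
    using assms by (rule translate_info_pullback)
  moreover have "cost (pullback \<phi> \<gamma> A) e = cost A f"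
    using assms by (rule cost_pullback)
  ultimately show ?thesis by (simp add: result_def split: enat.split)
qed

text \<open>The function \<open>\<gamma>\<close> need not be injective: if the values of \<open>l\<close> on the image of \<open>J\<close> are known in
  advance, it is constant, and the answer to the query that replaces \<open>l\<close> is ignored.\<close>
lemma min_error_pullback:
  fixes S :: "'e \<Rightarrow> 'g::banach" and S' :: "'f \<Rightarrow> 'g" and \<Lambda> :: "('e \<Rightarrow> 'k) set" and \<Lambda>' :: "('f \<Rightarrow> 'k) set"
  assumes J: "\<And>e. e \<in> E \<Longrightarrow> J e \<in> F"
    and lift: "\<And>l. l \<in> \<Lambda>' \<Longrightarrow> \<exists>l'\<in>\<Lambda>. \<exists>\<gamma>. \<forall>e\<in>E. l (J e) = \<gamma> (l' e)"
    and S: "\<And>e. e \<in> E \<Longrightarrow> S e = S' (J e)"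
  shows "min_error s n S E \<Lambda> \<le> min_error s n S' F \<Lambda>'"
proof -
  from lift obtain \<phi> \<gamma> where \<phi>: "\<And>l. l \<in> \<Lambda>' \<Longrightarrow> \<phi> l \<in> \<Lambda>"
    and \<gamma>: "\<And>l e. l \<in> \<Lambda>' \<Longrightarrow> e \<in> E \<Longrightarrow> l (J e) = \<gamma> l (\<phi> l e)"
    by metis
  define T :: "('f, 'k, 'g) algorithm \<Rightarrow> ('e, 'k, 'g) algorithm" where "T = pullback \<phi> \<gamma>"
  have T: "T A \<in> algorithms \<Lambda>" if "A \<in> algorithms \<Lambda>'" for A
    unfolding T_def by (rule pullback_in_algorithms[OF that \<phi>])
  have T_cost: "cost (T A) e = cost A (J e)" if "A \<in> algorithms \<Lambda>'" "e \<in> E" for A e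
    unfolding T_def by (rule cost_pullback[where \<Lambda>' = \<Lambda>']) (use that \<gamma> in auto)
  have T_result: "result (T A) e = result A (J e)" if "A \<in> algorithms \<Lambda>'" "e \<in> E" for A e
    unfolding T_def by (rule result_pullback[where \<Lambda>' = \<Lambda>']) (use that \<gamma> in auto)
  have det: "det_cost E (T A) \<le> det_cost F A" "det_error S E (T A) \<le> det_error S' F A"
    if "A \<in> algorithms \<Lambda>'" for A
    unfolding det_cost_def det_error_def using that
    by (auto intro!: SUP_least SUP_upper2[OF J] simp: T_cost T_result S)
  have ran: "randomized_algorithm E \<Lambda> M (\<lambda>\<omega>. T (A \<omega>))"
    "ran_cost E M (\<lambda>\<omega>. T (A \<omega>)) \<le> ran_cost F M A"
    "ran_error S E M (\<lambda>\<omega>. T (A \<omega>)) \<le> ran_error S' F M A"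
    if A: "randomized_algorithm F \<Lambda>' M A"
    for M :: "('f, 'k, 'g) algorithm measure" and A
  proof -
    have alg: "A \<omega> \<in> algorithms \<Lambda>'" if "\<omega> \<in> space M" for \<omega>
      using A that by (simp add: randomized_algorithm_def)
    show "randomized_algorithm E \<Lambda> M (\<lambda>\<omega>. T (A \<omega>))"
      unfolding randomized_algorithm_def
    proof (intro conjI ballI)
      show "prob_space M" using A by (simp add: randomized_algorithm_def)
      show "T (A \<omega>) \<in> algorithms \<Lambda>" if "\<omega> \<in> space M" for \<omega>
        using T alg that by blast
      fix e assume e: "e \<in> E"
      show "(\<lambda>\<omega>. cost (T (A \<omega>)) e) \<in> measurable M (count_space UNIV)"
        using A J[OF e] by (subst measurable_cong[OF T_cost]) (auto simp: alg e randomized_algorithm_def)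
      show "(\<lambda>\<omega>. result (T (A \<omega>)) e) \<in> borel_measurable M"
        using A J[OF e] by (subst measurable_cong[OF T_result]) (auto simp: alg e randomized_algorithm_def)
      have "\<exists>D. countable D \<and> (AE \<omega> in M. result (A \<omega>) (J e) \<in> closure D)"
        using A J[OF e] by (simp add: randomized_algorithm_def)
      moreover have "(AE \<omega> in M. result (T (A \<omega>)) e \<in> closure D) \<longleftrightarrow>
          (AE \<omega> in M. result (A \<omega>) (J e) \<in> closure D)" for D
        by (rule AE_cong) (simp add: T_result alg e)
      ultimately show "\<exists>D. countable D \<and> (AE \<omega> in M. result (T (A \<omega>)) e \<in> closure D)"
        by simp
    qed
    show "ran_cost E M (\<lambda>\<omega>. T (A \<omega>)) \<le> ran_cost F M A"
      unfolding ran_cost_def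
    proof (rule SUP_least)
      fix e assume e: "e \<in> E"
      have "(\<integral>\<^sup>+\<omega>. ennreal_of_enat (cost (T (A \<omega>)) e) \<partial>M) = (\<integral>\<^sup>+\<omega>. ennreal_of_enat (cost (A \<omega>) (J e)) \<partial>M)"
        by (rule nn_integral_cong) (simp add: T_cost alg e)
      also have "\<dots> \<le> (SUP f\<in>F. \<integral>\<^sup>+\<omega>. ennreal_of_enat (cost (A \<omega>) f) \<partial>M)"
        using J[OF e] by (rule SUP_upper)
      finally show "(\<integral>\<^sup>+\<omega>. ennreal_of_enat (cost (T (A \<omega>)) e) \<partial>M) \<le> \<dots>" .
    qed
    show "ran_error S E M (\<lambda>\<omega>. T (A \<omega>)) \<le> ran_error S' F M A"
      unfolding ran_error_def
    proof (rule SUP_least)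
      fix e assume e: "e \<in> E"
      have "(\<integral>\<^sup>+\<omega>. ennreal (norm (S e - result (T (A \<omega>)) e)) \<partial>M)
          = (\<integral>\<^sup>+\<omega>. ennreal (norm (S' (J e) - result (A \<omega>) (J e))) \<partial>M)"
        by (rule nn_integral_cong) (simp add: T_result S alg e)
      also have "\<dots> \<le> (SUP f\<in>F. \<integral>\<^sup>+\<omega>. ennreal (norm (S' f - result (A \<omega>) f)) \<partial>M)"
        using J[OF e] by (rule SUP_upper)
      finally show "(\<integral>\<^sup>+\<omega>. ennreal (norm (S e - result (T (A \<omega>)) e)) \<partial>M) \<le> \<dots>" .
    qed
  qed
  have na: "non_adaptive (T A)" if "non_adaptive A" for A
    unfolding T_def by (rule non_adaptive_pullback[OF that])
  show ?thesis
  proof (cases s)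
    case Det
    show ?thesis unfolding Det min_error.simps
      by (rule Inf_mono) (use T det in \<open>fastforce intro: order_trans\<close>)
  next
    case DetNon
    show ?thesis unfolding DetNon min_error.simps
      by (rule Inf_mono) (use T det na in \<open>fastforce intro: order_trans\<close>)
  next
    case Ran
    show ?thesis unfolding Ran min_error.simps(3)[of n S' F \<Lambda>']
    proof (rule Inf_greatest, clarify)
      fix M :: "('f, 'k, 'g) algorithm measure"
        and A :: "('f, 'k, 'g) algorithm \<Rightarrow> ('f, 'k, 'g) algorithm"
      assume A: "randomized_algorithm F \<Lambda>' M A" "ran_cost F M A \<le> of_nat n"
      have "min_error Ran n S E \<Lambda> \<le> ran_error S E M (\<lambda>\<omega>. T (A \<omega>))"
        using ran(1)[OF A(1)] order_trans[OF ran(2)[OF A(1)] A(2)] by (rule min_error_Ran_le)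
      also have "\<dots> \<le> ran_error S' F M A" by (rule ran(3)[OF A(1)])
      finally show "min_error Ran n S E \<Lambda> \<le> ran_error S' F M A" .
    qed
  next
    case RanNon
    show ?thesis unfolding RanNon min_error.simps(4)[of n S' F \<Lambda>']
    proof (rule Inf_greatest, clarify)
      fix M :: "('f, 'k, 'g) algorithm measure"
        and A :: "('f, 'k, 'g) algorithm \<Rightarrow> ('f, 'k, 'g) algorithm"
      assume A: "randomized_algorithm F \<Lambda>' M A" "\<forall>\<omega>\<in>space M. non_adaptive (A \<omega>)"
        "ran_cost F M A \<le> of_nat n"
      have "\<forall>\<omega>\<in>space M. non_adaptive (T (A \<omega>))" using na A(2) by blast
      with ran(1)[OF A(1)] have "min_error RanNon n S E \<Lambda> \<le> ran_error S E M (\<lambda>\<omega>. T (A \<omega>))"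
        using order_trans[OF ran(2)[OF A(1)] A(3)] by (rule min_error_RanNon_le)
      also have "\<dots> \<le> ran_error S' F M A" by (rule ran(3)[OF A(1)])
      finally show "min_error RanNon n S E \<Lambda> \<le> ran_error S' F M A" .
    qed
  qed
qed

section \<open>Running two algorithms in succession\<close>

text \<open>A list of answers of the combined run contains no marker for the end of the first phase; that
  point is recovered as the first prefix at which \<open>A\<close> stops.\<close>
definition finished :: "('f, 'k, 'g) algorithm \<Rightarrow> 'k list \<Rightarrow> bool" where
  "finished A ys \<longleftrightarrow> (\<exists>i\<le>length ys. stop A (take i ys))"

definition switch :: "('f, 'k, 'g) algorithm \<Rightarrow> 'k list \<Rightarrow> nat" where
  "switch A ys = (LEAST i. stop A (take i ys))"

text \<open>The default output \<open>0\<close> matters at the empty list, whose output is the result of a run that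
  never ends.  In a randomized algorithm this happens on a null set that depends on the input; the
  constant default keeps the result measurable there, whereas the sum of the two outputs at the
  empty list need not be measurable.\<close>
definition run_both ::
    "('f, 'k, 'g) algorithm \<Rightarrow> ('f, 'k, 'g) algorithm \<Rightarrow> ('f, 'k, 'g::real_normed_vector) algorithm"
  where
  "run_both A B = Algorithm
     (\<lambda>ys. if finished A ys then query B (drop (switch A ys) ys) else query A ys)
     (\<lambda>ys. finished A ys \<and> stop B (drop (switch A ys) ys))
     (\<lambda>ys. if finished A ys \<and> stop B (drop (switch A ys) ys)
           then out A (take (switch A ys) ys) + out B (drop (switch A ys) ys) else 0)"

lemma run_both_in_algorithms:
  "A \<in> algorithms \<Lambda> \<Longrightarrow> B \<in> algorithms \<Lambda> \<Longrightarrow> run_both A B \<in> algorithms \<Lambda>"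
  by (auto simp: algorithms_def run_both_def)

text \<open>Whether a non-adaptive \<open>A\<close> stops depends only on the number of answers, so the switch to the
  second phase occurs at a predetermined time.\<close>
lemma non_adaptive_run_both:
  assumes "non_adaptive A" "non_adaptive B"
  shows "non_adaptive (run_both A B)"
  unfolding non_adaptive_def
proof (intro allI impI)
  fix ys zs :: "'b list"
  assume len: "length ys = length zs"
  have "stop A (take i ys) = stop A (take i zs)" for i
    using assms(1) len by (simp add: non_adaptive_def)
  then have "finished A ys = finished A zs" "switch A ys = switch A zs"
    using len by (simp_all add: finished_def switch_def)
  moreover have "query A ys = query A zs"
    "query B (drop i ys) = query B (drop i zs)" "stop B (drop i ys) = stop B (drop i zs)" for i
    using assms len unfolding non_adaptive_def by (metis, (metis length_drop)+)
  ultimately show "query (run_both A B) ys = query (run_both A B) zs \<and>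
      stop (run_both A B) ys = stop (run_both A B) zs"
    by (simp add: run_both_def)
qed

lemma finished_info_iff: "finished A (info A f n) \<longleftrightarrow> (\<exists>i\<le>n. stop A (info A f i))"
  by (auto simp: finished_def take_info)

lemma info_run_both_first:
  "(\<And>i. i < n \<Longrightarrow> \<not> stop A (info A f i)) \<Longrightarrow> info (run_both A B) f n = info A f n"
  by (induction n) (auto simp: run_both_def finished_info_iff)

lemma finished_after_switch:
  assumes "cost A f = enat N"
  shows "finished A (info A f N @ zs)" "switch A (info A f N @ zs) = N"
proof -
  have N: "stop A (info A f N)" "\<And>i. i < N \<Longrightarrow> \<not> stop A (info A f i)"
    using assms by (auto simp: cost_eq_enat_iff)
  show "finished A (info A f N @ zs)"
    using N(1) by (auto simp: finished_def intro!: exI[of _ N])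
  show "switch A (info A f N @ zs) = N"
    unfolding switch_def
  proof (rule Least_equality)
    show "stop A (take N (info A f N @ zs))" using N(1) by simp
    fix i assume i: "stop A (take i (info A f N @ zs))"
    show "N \<le> i"
    proof (rule ccontr)
      assume "\<not> N \<le> i"
      with i N(2)[of i] show False by (simp add: take_info)
    qed
  qed
qed

lemma info_run_both_second:
  assumes "cost A f = enat N"
  shows "info (run_both A B) f (N + j) = info A f N @ info B f j"
proof (induction j)
  case 0
  show ?case using assms by (simp add: cost_eq_enat_iff info_run_both_first)
next
  case (Suc j)
  then show ?case
    by (simp add: run_both_def finished_after_switch[OF assms])
qed

lemma stop_run_both_second:
  assumes "cost A f = enat N"
  shows "stop (run_both A B) (info (run_both A B) f (N + j)) = stop B (info B f j)"
  unfolding info_run_both_second[OF assms] by (simp add: run_both_def finished_after_switch[OF assms])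

lemma stop_run_both_first:
  assumes "\<And>i. i \<le> n \<Longrightarrow> \<not> stop A (info A f i)"
  shows "\<not> stop (run_both A B) (info (run_both A B) f n)"
proof -
  have "info (run_both A B) f n = info A f n" using assms by (simp add: info_run_both_first)
  then show ?thesis using assms by (simp add: run_both_def finished_info_iff)
qed

lemma cost_run_both: "cost (run_both A B) f = cost A f + cost B f"
proof (cases "cost A f")
  case infinity
  then have "cost (run_both A B) f = \<infinity>"
    by (simp add: cost_eq_infinity_iff stop_run_both_first)
  with infinity show ?thesis by simp
next
  case (enat N)
  have before: "\<not> stop (run_both A B) (info (run_both A B) f i)" if "i < N" for i
    using that enat by (intro stop_run_both_first) (auto simp: cost_eq_enat_iff)
  note after = stop_run_both_second[OF enat]
  show ?thesis
  proof (cases "cost B f")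
    case infinity
    have "\<not> stop (run_both A B) (info (run_both A B) f i)" for i
      using before[of i] after[of B "i - N"] infinity
      by (cases "i < N") (auto simp: cost_eq_infinity_iff)
    then have "cost (run_both A B) f = \<infinity>" by (simp add: cost_eq_infinity_iff)
    with infinity show ?thesis by simp
  next
    case (enat M)
    have "\<not> stop (run_both A B) (info (run_both A B) f i)" if "i < N + M" for i
      using before[of i] after[of B "i - N"] enat that
      by (cases "i < N") (auto simp: cost_eq_enat_iff)
    then have "cost (run_both A B) f = enat (N + M)"
      using enat by (auto simp: cost_eq_enat_iff after)
    with enat \<open>cost A f = enat N\<close> show ?thesis by simp
  qed
qed

text \<open>If the combined run never ends, it cannot stop at the empty list either, so the default output
  is the result.\<close>
lemma result_run_both:
  "result (run_both A B) f = (if cost (run_both A B) f = \<infinity> then 0 else result A f + result B f)"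
proof (cases "cost (run_both A B) f = \<infinity>")
  case True
  then have "\<not> stop (run_both A B) []"
    unfolding cost_eq_infinity_iff by (metis info.simps(1))
  then have "out (run_both A B) [] = 0" by (auto simp: run_both_def)
  with True show ?thesis by (simp add: result_def)
next
  case False
  then obtain N M where NM: "cost A f = enat N" "cost B f = enat M"
    by (cases "cost A f"; cases "cost B f") (auto simp: cost_run_both)
  then have "stop B (info B f M)" by (simp add: cost_eq_enat_iff)
  then have "out (run_both A B) (info (run_both A B) f (N + M)) = out A (info A f N) + out B (info B f M)"
    unfolding info_run_both_second[OF NM(1)]
    by (simp add: run_both_def finished_after_switch[OF NM(1)])
  with NM show ?thesis by (simp add: result_def cost_run_both)
qed

section \<open>Sums of separably valued random elements\<close>

text \<open>Almost surely \<open>X \<omega> + Y \<omega>\<close> lies in an open set \<open>U\<close> if and only if \<open>X \<omega>\<close> and \<open>Y \<omega>\<close> are close to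
  points \<open>c\<close> and \<open>d\<close> of the two countable sets such that a ball around \<open>c + d\<close> is contained in \<open>U\<close>.
  This describes the preimage of \<open>U\<close> up to a null set by countably many measurable conditions;
  completeness of the measure absorbs the null set.\<close>
lemma (in complete_measure) borel_measurable_add_separable:
  fixes X Y :: "'a \<Rightarrow> 'b::real_normed_vector"
  assumes X: "X \<in> borel_measurable M" "AE \<omega> in M. X \<omega> \<in> closure C" "countable C"
    and Y: "Y \<in> borel_measurable M" "AE \<omega> in M. Y \<omega> \<in> closure D" "countable D"
  shows "(\<lambda>\<omega>. X \<omega> + Y \<omega>) \<in> borel_measurable M"
proof (rule borel_measurableI)
  fix U :: "'b set" assume "open U"
  define R where "R = (\<Union>c\<in>C. \<Union>d\<in>D. \<Union>n\<in>{n. ball (c + d) (2 / real (Suc n)) \<subseteq> U}.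
    (X -` ball c (1 / real (Suc n)) \<inter> space M) \<inter> (Y -` ball d (1 / real (Suc n)) \<inter> space M))"
  have "R \<in> sets M"
    unfolding R_def using X(1,3) Y(1,3)
    by (intro sets.countable_UN' sets.Int measurable_sets) auto
  moreover have "AE \<omega> in M. \<omega> \<in> R \<longleftrightarrow> \<omega> \<in> (\<lambda>\<omega>. X \<omega> + Y \<omega>) -` U \<inter> space M"
    using X(2) Y(2) AE_space
  proof eventually_elim
    case (elim \<omega>)
    show ?case
    proof
      assume "\<omega> \<in> R"
      then obtain c d n where n: "ball (c + d) (2 / real (Suc n)) \<subseteq> U"
        and "dist c (X \<omega>) < 1 / real (Suc n)" "dist d (Y \<omega>) < 1 / real (Suc n)" "\<omega> \<in> space M"
        by (auto simp: R_def)
      moreover have "dist (c + d) (X \<omega> + Y \<omega>) \<le> dist c (X \<omega>) + dist d (Y \<omega>)"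
        by (rule dist_triangle_add)
      moreover have "2 / real (Suc n) = 1 / real (Suc n) + 1 / real (Suc n)"
        by simp
      ultimately have "X \<omega> + Y \<omega> \<in> ball (c + d) (2 / real (Suc n))"
        unfolding mem_ball by linarith
      then show "\<omega> \<in> (\<lambda>\<omega>. X \<omega> + Y \<omega>) -` U \<inter> space M"
        using n elim(3) by auto
    next
      assume "\<omega> \<in> (\<lambda>\<omega>. X \<omega> + Y \<omega>) -` U \<inter> space M"
      then obtain e where e: "e > 0" "ball (X \<omega> + Y \<omega>) e \<subseteq> U"
        using \<open>open U\<close> by (auto simp: open_contains_ball)
      \<comment> \<open>The centre \<open>c + d\<close> is closer than \<open>2 / Suc n\<close> to \<open>X \<omega> + Y \<omega>\<close> and its ball has
        radius \<open>2 / Suc n\<close>, hence the quarter.\<close>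
      obtain n where n: "1 / real (Suc n) < e / 4"
        using reals_Archimedean[of "e / 4"] e(1) unfolding inverse_eq_divide by auto
      have r: "0 < 1 / real (Suc n)" by simp
      obtain c d where c: "c \<in> C" "dist c (X \<omega>) < 1 / real (Suc n)"
        and d: "d \<in> D" "dist d (Y \<omega>) < 1 / real (Suc n)"
        using elim(1,2) r unfolding closure_approachable by blast
      have "ball (c + d) (2 / real (Suc n)) \<subseteq> ball (X \<omega> + Y \<omega>) e"
      proof
        fix z assume "z \<in> ball (c + d) (2 / real (Suc n))"
        then have "dist (X \<omega> + Y \<omega>) z < dist (X \<omega> + Y \<omega>) (c + d) + 2 / real (Suc n)"
          using dist_triangle[of "X \<omega> + Y \<omega>" z "c + d"] by simp
        moreover have "dist (X \<omega> + Y \<omega>) (c + d) \<le> dist (X \<omega>) c + dist (Y \<omega>) d"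
          by (rule dist_triangle_add)
        moreover have "2 / real (Suc n) = 1 / real (Suc n) + 1 / real (Suc n)"
          by simp
        moreover have "dist (X \<omega>) c < 1 / real (Suc n)" "dist (Y \<omega>) d < 1 / real (Suc n)"
          by (subst dist_commute, rule c(2)) (subst dist_commute, rule d(2))
        ultimately show "z \<in> ball (X \<omega> + Y \<omega>) e"
          using n unfolding mem_ball by linarith
      qed
      then have "n \<in> {n. ball (c + d) (2 / real (Suc n)) \<subseteq> U}" using e(2) by blast
      moreover have "\<omega> \<in> X -` ball c (1 / real (Suc n)) \<inter> space M \<inter>
          (Y -` ball d (1 / real (Suc n)) \<inter> space M)"
        using c(2) d(2) elim(3) by (simp only: vimage_def mem_ball Int_iff mem_Collect_eq)
      ultimately show "\<omega> \<in> R"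
        unfolding R_def using c(1) d(1) by blast
    qed
  qed
  ultimately show "(\<lambda>\<omega>. X \<omega> + Y \<omega>) -` U \<inter> space M \<in> sets M"
    using in_sets_AE[of R "(\<lambda>\<omega>. X \<omega> + Y \<omega>) -` U \<inter> space M"] by blast
qed

lemma add_in_closure_sums:
  fixes x y :: "'b::real_normed_vector"
  assumes "x \<in> closure C" "y \<in> closure D"
  shows "x + y \<in> closure ((\<lambda>(c, d). c + d) ` (C \<times> D))"
  unfolding closure_approachable
proof (intro allI impI)
  fix e :: real assume "e > 0"
  then have "e / 2 > 0" by simp
  then obtain c d where cd: "c \<in> C" "dist c x < e / 2" "d \<in> D" "dist d y < e / 2"
    using assms unfolding closure_approachable by meson
  then have "dist (c + d) (x + y) < e"
    using dist_triangle_add[of c d x y] by simp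
  then show "\<exists>z\<in>(\<lambda>(c, d). c + d) ` (C \<times> D). dist z (x + y) < e"
    using cd by auto
qed

section \<open>Subadditivity of the minimal errors\<close>

lemma distr_pair_snd:
  assumes "prob_space M" "sigma_finite_measure N"
  shows "distr (M \<Otimes>\<^sub>M N) N snd = N"
proof -
  interpret prob_space M by fact
  interpret N: sigma_finite_measure N by fact
  show ?thesis
  proof (rule measure_eqI)
    fix A assume A: "A \<in> sets (distr (M \<Otimes>\<^sub>M N) N snd)"
    then have "snd -` A \<inter> space (M \<Otimes>\<^sub>M N) = space M \<times> A"
      by (auto simp: space_pair_measure dest: sets.sets_into_space)
    then show "emeasure (distr (M \<Otimes>\<^sub>M N) N snd) A = emeasure N A"
      using A by (simp add: emeasure_distr N.emeasure_pair_measure_Times emeasure_space_1)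
  qed simp
qed

lemma measurable_add_enat:
  fixes f g :: "'a \<Rightarrow> enat"
  assumes "f \<in> measurable M (count_space UNIV)" "g \<in> measurable M (count_space UNIV)"
  shows "(\<lambda>x. f x + g x) \<in> measurable M (count_space UNIV)"
  using assms by (intro measurable_compose_countable'[where g = f and I = UNIV and f = "\<lambda>i x. i + g x"]
      measurable_compose[OF assms(2)]) auto

lemma ennreal_of_enat_add: "ennreal_of_enat (a + b) = ennreal_of_enat a + ennreal_of_enat b"
  by (cases a; cases b) auto

lemma borel_measurable_error:
  fixes Y :: "'a \<Rightarrow> 'g::real_normed_vector"
  assumes "Y \<in> borel_measurable M"
  shows "(\<lambda>\<omega>. ennreal (norm (c - Y \<omega>))) \<in> borel_measurable M"
  by (rule measurable_compose[OF assms])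
    (intro measurable_compose[OF _ measurable_ennreal] borel_measurable_continuous_onI
      continuous_intros)

lemma det_run_both:
  fixes A B :: "('f, 'k, 'g::real_normed_vector) algorithm"
  assumes "det_cost F A \<le> enat m" "det_cost F B \<le> enat n"
  shows "det_cost F (run_both A B) \<le> enat (m + n)"
    and "det_error (\<lambda>f. S f + T f) F (run_both A B) \<le> det_error S F A + det_error T F B"
proof -
  have cost: "cost (run_both A B) f \<le> enat (m + n)" if "f \<in> F" for f
  proof -
    have "cost A f \<le> enat m" "cost B f \<le> enat n"
      using assms that by (auto simp: det_cost_def SUP_le_iff)
    from add_mono[OF this] show ?thesis by (simp add: cost_run_both)
  qed
  then show "det_cost F (run_both A B) \<le> enat (m + n)"
    by (auto simp: det_cost_def intro: SUP_least)
  show "det_error (\<lambda>f. S f + T f) F (run_both A B) \<le> det_error S F A + det_error T F B"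
    unfolding det_error_def
  proof (rule SUP_least)
    fix f assume f: "f \<in> F"
    have "result (run_both A B) f = result A f + result B f"
      using cost[OF f] by (auto simp: result_run_both)
    then have "norm (S f + T f - result (run_both A B) f)
        \<le> norm (S f - result A f) + norm (T f - result B f)"
      by (simp add: norm_diff_triangle_ineq)
    then have "ennreal (norm (S f + T f - result (run_both A B) f))
        \<le> ennreal (norm (S f - result A f)) + ennreal (norm (T f - result B f))"
      by (simp flip: ennreal_plus add: ennreal_leI)
    also have "\<dots> \<le> (SUP f\<in>F. ennreal (norm (S f - result A f)))
        + (SUP f\<in>F. ennreal (norm (T f - result B f)))"
      by (intro add_mono SUP_upper f)
    finally show "ennreal (norm (S f + T f - result (run_both A B) f)) \<le> \<dots>" .
  qed
qed

text \<open>The expected cost is finite, so the cost is finite almost everywhere, and there the combined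
  result is the sum of the two results.  Elsewhere it is \<open>0\<close>, which does not affect the expected
  error.\<close>
lemma ran_run_both:
  fixes M :: "'v measure" and N :: "'w measure"
    and A :: "'v \<Rightarrow> ('f, 'k, 'g::banach) algorithm" and B :: "'w \<Rightarrow> ('f, 'k, 'g) algorithm"
  defines "P \<equiv> completion (M \<Otimes>\<^sub>M N)" and "C \<equiv> \<lambda>\<omega>. run_both (A (fst \<omega>)) (B (snd \<omega>))"
  assumes A: "randomized_algorithm F \<Lambda> M A" "ran_cost F M A \<le> of_nat m"
    and B: "randomized_algorithm F \<Lambda> N B" "ran_cost F N B \<le> of_nat n"
  shows "randomized_algorithm F \<Lambda> P C"
    and "ran_cost F P C \<le> of_nat (m + n)"
    and "ran_error (\<lambda>f. S f + T f) F P C \<le> ran_error S F M A + ran_error T F N B"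
proof -
  interpret M: prob_space M using A(1) by (simp add: randomized_algorithm_def)
  interpret N: prob_space N using B(1) by (simp add: randomized_algorithm_def)
  interpret MN: pair_prob_space M N ..
  interpret P: prob_space P unfolding P_def by (rule MN.prob_space_completion)
  interpret P: complete_measure P unfolding P_def by (rule completion.complete_measure_axioms)
  have distr: "distr (M \<Otimes>\<^sub>M N) M fst = M" "distr (M \<Otimes>\<^sub>M N) N snd = N"
    by (rule N.distr_pair_fst, rule distr_pair_snd) unfold_locales
  have fst_P: "(\<lambda>\<omega>. h (fst \<omega>)) \<in> measurable P L" if "h \<in> measurable M L" for h and L :: "'z measure"
    unfolding P_def using that by (intro measurable_completion measurable_compose[OF measurable_fst])
  have snd_P: "(\<lambda>\<omega>. h (snd \<omega>)) \<in> measurable P L" if "h \<in> measurable N L" for h and L :: "'z measure"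
    unfolding P_def using that by (intro measurable_completion measurable_compose[OF measurable_snd])
  have AE_fst: "AE \<omega> in P. Q (fst \<omega>)" if "AE x in M. Q x" for Q
    unfolding P_def by (rule AE_completion, rule AE_distrD[OF measurable_fst], unfold distr) (rule that)
  have AE_snd: "AE \<omega> in P. Q (snd \<omega>)" if "AE x in N. Q x" for Q
    unfolding P_def by (rule AE_completion, rule AE_distrD[OF measurable_snd], unfold distr) (rule that)
  have int_fst: "(\<integral>\<^sup>+\<omega>. h (fst \<omega>) \<partial>P) = (\<integral>\<^sup>+x. h x \<partial>M)" if "h \<in> borel_measurable M" for h
    unfolding P_def nn_integral_completion
    using nn_integral_distr[of fst "M \<Otimes>\<^sub>M N" M h, OF measurable_fst] that by (simp add: distr(1))
  have int_snd: "(\<integral>\<^sup>+\<omega>. h (snd \<omega>) \<partial>P) = (\<integral>\<^sup>+x. h x \<partial>N)" if "h \<in> borel_measurable N" for h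
    unfolding P_def nn_integral_completion
    using nn_integral_distr[of snd "M \<Otimes>\<^sub>M N" N h, OF measurable_snd] that by (simp add: distr(2))
  have space: "fst \<omega> \<in> space M" "snd \<omega> \<in> space N" if "\<omega> \<in> space P" for \<omega>
    using that by (auto simp: P_def space_pair_measure)
  have costA: "(\<lambda>\<omega>. cost (A \<omega>) f) \<in> measurable M (count_space UNIV)"
    and resA: "(\<lambda>\<omega>. result (A \<omega>) f) \<in> borel_measurable M"
    and sepA: "\<exists>D. countable D \<and> (AE \<omega> in M. result (A \<omega>) f \<in> closure D)" if "f \<in> F" for f
    using A(1) that by (auto simp: randomized_algorithm_def)
  have costB: "(\<lambda>\<omega>. cost (B \<omega>) f) \<in> measurable N (count_space UNIV)"
    and resB: "(\<lambda>\<omega>. result (B \<omega>) f) \<in> borel_measurable N"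
    and sepB: "\<exists>D. countable D \<and> (AE \<omega> in N. result (B \<omega>) f \<in> closure D)" if "f \<in> F" for f
    using B(1) that by (auto simp: randomized_algorithm_def)
  have costC: "(\<lambda>\<omega>. cost (C \<omega>) f) \<in> measurable P (count_space UNIV)" if f: "f \<in> F" for f
    unfolding C_def cost_run_both
    by (intro measurable_add_enat fst_P[OF costA] snd_P[OF costB] f)
  have int_cost: "(\<integral>\<^sup>+\<omega>. ennreal_of_enat (cost (C \<omega>) f) \<partial>P) \<le> of_nat (m + n)" if f: "f \<in> F" for f
  proof -
    have mA: "(\<lambda>\<omega>. ennreal_of_enat (cost (A \<omega>) f)) \<in> borel_measurable M"
      by (rule measurable_compose[OF costA[OF f]]) simp
    have mB: "(\<lambda>\<omega>. ennreal_of_enat (cost (B \<omega>) f)) \<in> borel_measurable N"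
      by (rule measurable_compose[OF costB[OF f]]) simp
    have "(\<integral>\<^sup>+\<omega>. ennreal_of_enat (cost (C \<omega>) f) \<partial>P)
        = (\<integral>\<^sup>+x. ennreal_of_enat (cost (A x) f) \<partial>M) + (\<integral>\<^sup>+y. ennreal_of_enat (cost (B y) f) \<partial>N)"
      unfolding C_def cost_run_both ennreal_of_enat_add
      by (subst nn_integral_add[OF fst_P[OF mA] snd_P[OF mB]]) (simp add: int_fst[OF mA] int_snd[OF mB])
    also have "\<dots> \<le> of_nat m + of_nat n"
      using A(2) B(2) f by (intro add_mono) (auto simp: ran_cost_def SUP_le_iff)
    finally show ?thesis by simp
  qed
  have result_C: "AE \<omega> in P. result (C \<omega>) f = result (A (fst \<omega>)) f + result (B (snd \<omega>)) f"
    if f: "f \<in> F" for f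
  proof -
    have "AE \<omega> in P. ennreal_of_enat (cost (C \<omega>) f) \<noteq> \<infinity>"
    proof (rule nn_integral_PInf_AE)
      show "(\<lambda>\<omega>. ennreal_of_enat (cost (C \<omega>) f)) \<in> borel_measurable P"
        by (rule measurable_compose[OF costC[OF f]]) simp
      show "(\<integral>\<^sup>+\<omega>. ennreal_of_enat (cost (C \<omega>) f) \<partial>P) \<noteq> \<infinity>"
        using int_cost[OF f] by (auto simp: top_unique)
    qed
    then show ?thesis
      by eventually_elim (auto simp: C_def result_run_both)
  qed
  show "randomized_algorithm F \<Lambda> P C"
    unfolding randomized_algorithm_def
  proof (intro conjI ballI)
    show "prob_space P" by unfold_locales
    show "C \<omega> \<in> algorithms \<Lambda>" if "\<omega> \<in> space P" for \<omega>
      unfolding C_def using A(1) B(1) space[OF that]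
      by (intro run_both_in_algorithms) (auto simp: randomized_algorithm_def)
    fix f assume f: "f \<in> F"
    show "(\<lambda>\<omega>. cost (C \<omega>) f) \<in> measurable P (count_space UNIV)" by (rule costC[OF f])
    obtain D where D: "countable D" "AE \<omega> in M. result (A \<omega>) f \<in> closure D"
      using sepA[OF f] by blast
    obtain E where E: "countable E" "AE \<omega> in N. result (B \<omega>) f \<in> closure E"
      using sepB[OF f] by blast
    have sum: "(\<lambda>\<omega>. result (A (fst \<omega>)) f + result (B (snd \<omega>)) f) \<in> borel_measurable P"
      by (rule P.borel_measurable_add_separable[OF fst_P[OF resA[OF f]] AE_fst[OF D(2)] D(1)
            snd_P[OF resB[OF f]] AE_snd[OF E(2)] E(1)])
    have "(\<lambda>\<omega>. if cost (C \<omega>) f = \<infinity> then 0 else result (A (fst \<omega>)) f + result (B (snd \<omega>)) f)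
        \<in> borel_measurable P"
      by (intro measurable_If sum measurable_const predE pred_count_space_const1 costC f) simp_all
    then show "(\<lambda>\<omega>. result (C \<omega>) f) \<in> borel_measurable P"
      by (simp add: C_def result_run_both)
    have "AE \<omega> in P. result (C \<omega>) f \<in> closure ((\<lambda>(c, d). c + d) ` (D \<times> E))"
      using result_C[OF f] AE_fst[OF D(2)] AE_snd[OF E(2)]
      by eventually_elim (simp add: add_in_closure_sums)
    then show "\<exists>D. countable D \<and> (AE \<omega> in P. result (C \<omega>) f \<in> closure D)"
      using D(1) E(1) by (intro exI[of _ "(\<lambda>(c, d). c + d) ` (D \<times> E)"]) auto
  qed
  show "ran_cost F P C \<le> of_nat (m + n)"
    unfolding ran_cost_def by (rule SUP_least) (rule int_cost)
  show "ran_error (\<lambda>f. S f + T f) F P C \<le> ran_error S F M A + ran_error T F N B"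
    unfolding ran_error_def
  proof (rule SUP_least)
    fix f assume f: "f \<in> F"
    note eA = borel_measurable_error[OF resA[OF f], of "S f"]
    note eB = borel_measurable_error[OF resB[OF f], of "T f"]
    have "(\<integral>\<^sup>+\<omega>. ennreal (norm (S f + T f - result (C \<omega>) f)) \<partial>P)
        \<le> (\<integral>\<^sup>+\<omega>. ennreal (norm (S f - result (A (fst \<omega>)) f))
              + ennreal (norm (T f - result (B (snd \<omega>)) f)) \<partial>P)"
      using result_C[OF f]
      by (intro nn_integral_mono_AE, eventually_elim)
        (simp flip: ennreal_plus add: ennreal_leI norm_diff_triangle_ineq)
    also have "\<dots> = (\<integral>\<^sup>+x. ennreal (norm (S f - result (A x) f)) \<partial>M)
        + (\<integral>\<^sup>+y. ennreal (norm (T f - result (B y) f)) \<partial>N)"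
      by (subst nn_integral_add[OF fst_P[OF eA] snd_P[OF eB]]) (simp add: int_fst[OF eA] int_snd[OF eB])
    also have "\<dots> \<le> (SUP f\<in>F. \<integral>\<^sup>+x. ennreal (norm (S f - result (A x) f)) \<partial>M)
        + (SUP f\<in>F. \<integral>\<^sup>+y. ennreal (norm (T f - result (B y) f)) \<partial>N)"
      by (intro add_mono SUP_upper f)
    finally show "(\<integral>\<^sup>+\<omega>. ennreal (norm (S f + T f - result (C \<omega>) f)) \<partial>P) \<le> \<dots>" .
  qed
qed

text \<open>Infima of error sets need not be attained, so a bound by sums of members is passed to the
  infima with a slack \<open>e / 2\<close> on each side.\<close>
lemma le_add_Inf_ennreal:
  fixes c :: ennreal
  assumes "\<And>a b. a \<in> P \<Longrightarrow> b \<in> Q \<Longrightarrow> c \<le> a + b"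
  shows "c \<le> Inf P + Inf Q"
proof (rule ennreal_le_epsilon)
  fix e :: real assume fin: "Inf P + Inf Q < \<top>" and e: "0 < e"
  have less: "Inf B < Inf B + ennreal (e / 2)" if "Inf B < \<top>" for B :: "ennreal set"
  proof -
    obtain r where r: "0 \<le> r" "Inf B = ennreal r"
      using \<open>Inf B < \<top>\<close> by (cases "Inf B") auto
    then have "Inf B + ennreal (e / 2) = ennreal (r + e / 2)"
      using e by (simp add: ennreal_plus)
    with r e show ?thesis by (simp add: ennreal_lessI)
  qed
  from fin have "Inf P < \<top>" "Inf Q < \<top>"
    by (metis add_top_left_ennreal less_top, metis add_top_right_ennreal less_top)
  then obtain a b where a: "a \<in> P" "a < Inf P + ennreal (e / 2)"
    and b: "b \<in> Q" "b < Inf Q + ennreal (e / 2)"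
    using less[of P] less[of Q] unfolding Inf_less_iff[of P] Inf_less_iff[of Q] by blast
  have "c \<le> a + b" using a(1) b(1) by (rule assms)
  also have "\<dots> \<le> (Inf P + ennreal (e / 2)) + (Inf Q + ennreal (e / 2))"
    using a(2) b(2) by (intro add_mono) auto
  also have "\<dots> = Inf P + Inf Q + (ennreal (e / 2) + ennreal (e / 2))"
    by (simp only: ac_simps)
  also have "ennreal (e / 2) + ennreal (e / 2) = ennreal e"
    using ennreal_plus[of "e / 2" "e / 2"] e by simp
  finally show "c \<le> Inf P + Inf Q + ennreal e" .
qed

lemma min_error_Det_le:
  "A \<in> algorithms \<Lambda> \<Longrightarrow> det_cost F A \<le> enat n \<Longrightarrow> min_error Det n S F \<Lambda> \<le> det_error S F A"
  unfolding min_error.simps by (rule Inf_lower) auto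

lemma min_error_DetNon_le:
  "A \<in> algorithms \<Lambda> \<Longrightarrow> non_adaptive A \<Longrightarrow> det_cost F A \<le> enat n \<Longrightarrow>
    min_error DetNon n S F \<Lambda> \<le> det_error S F A"
  unfolding min_error.simps by (rule Inf_lower) auto

lemma min_error_add:
  fixes S T :: "'f \<Rightarrow> 'g::banach" and \<Lambda> :: "('f \<Rightarrow> 'k) set"
  shows "min_error s (m + n) (\<lambda>f. S f + T f) F \<Lambda> \<le> min_error s m S F \<Lambda> + min_error s n T F \<Lambda>"
proof (cases s)
  case Det
  show ?thesis
    unfolding Det min_error.simps(1)[of m] min_error.simps(1)[of n]
  proof (rule le_add_Inf_ennreal, clarify)
    fix A B :: "('f, 'k, 'g) algorithm"
    assume A: "A \<in> algorithms \<Lambda>" "det_cost F A \<le> enat m"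
      and B: "B \<in> algorithms \<Lambda>" "det_cost F B \<le> enat n"
    show "min_error Det (m + n) (\<lambda>f. S f + T f) F \<Lambda> \<le> det_error S F A + det_error T F B"
      using min_error_Det_le[OF run_both_in_algorithms[OF A(1) B(1)] det_run_both(1)[OF A(2) B(2)]]
        det_run_both(2)[OF A(2) B(2)] by (rule order_trans)
  qed
next
  case DetNon
  show ?thesis
    unfolding DetNon min_error.simps(2)[of m] min_error.simps(2)[of n]
  proof (rule le_add_Inf_ennreal, clarify)
    fix A B :: "('f, 'k, 'g) algorithm"
    assume A: "A \<in> algorithms \<Lambda>" "non_adaptive A" "det_cost F A \<le> enat m"
      and B: "B \<in> algorithms \<Lambda>" "non_adaptive B" "det_cost F B \<le> enat n"
    show "min_error DetNon (m + n) (\<lambda>f. S f + T f) F \<Lambda> \<le> det_error S F A + det_error T F B"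
      using min_error_DetNon_le[OF run_both_in_algorithms[OF A(1) B(1)]
          non_adaptive_run_both[OF A(2) B(2)] det_run_both(1)[OF A(3) B(3)]]
        det_run_both(2)[OF A(3) B(3)] by (rule order_trans)
  qed
next
  case Ran
  show ?thesis
    unfolding Ran min_error.simps(3)[of m] min_error.simps(3)[of n]
  proof (rule le_add_Inf_ennreal, clarify)
    fix M N :: "('f, 'k, 'g) algorithm measure"
      and A B :: "('f, 'k, 'g) algorithm \<Rightarrow> ('f, 'k, 'g) algorithm"
    assume A: "randomized_algorithm F \<Lambda> M A" "ran_cost F M A \<le> of_nat m"
      and B: "randomized_algorithm F \<Lambda> N B" "ran_cost F N B \<le> of_nat n"
    note run = ran_run_both[OF A B]
    show "min_error Ran (m + n) (\<lambda>f. S f + T f) F \<Lambda> \<le> ran_error S F M A + ran_error T F N B"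
      using min_error_Ran_le[OF run(1,2)] run(3) by (rule order_trans)
  qed
next
  case RanNon
  show ?thesis
    unfolding RanNon min_error.simps(4)[of m] min_error.simps(4)[of n]
  proof (rule le_add_Inf_ennreal, clarify)
    fix M N :: "('f, 'k, 'g) algorithm measure"
      and A B :: "('f, 'k, 'g) algorithm \<Rightarrow> ('f, 'k, 'g) algorithm"
    assume A: "randomized_algorithm F \<Lambda> M A" "ran_cost F M A \<le> of_nat m"
        "\<forall>\<omega>\<in>space M. non_adaptive (A \<omega>)"
      and B: "randomized_algorithm F \<Lambda> N B" "ran_cost F N B \<le> of_nat n"
        "\<forall>\<omega>\<in>space N. non_adaptive (B \<omega>)"
    note run = ran_run_both[OF A(1,2) B(1,2)]
    have "\<forall>\<omega>\<in>space (completion (M \<Otimes>\<^sub>M N)). non_adaptive (run_both (A (fst \<omega>)) (B (snd \<omega>)))"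
      using A(3) B(3) by (auto simp: space_pair_measure intro: non_adaptive_run_both)
    from min_error_RanNon_le[OF run(1) this run(2)] run(3)
    show "min_error RanNon (m + n) (\<lambda>f. S f + T f) F \<Lambda> \<le> ran_error S F M A + ran_error T F N B"
      by (rule order_trans)
  qed
qed

lemma det_error_perturb:
  fixes S T :: "'f \<Rightarrow> 'g::real_normed_vector"
  shows "det_error S F A \<le> (SUP f\<in>F. ennreal (norm (S f - T f))) + det_error T F A"
  unfolding det_error_def
proof (rule SUP_least)
  fix f assume f: "f \<in> F"
  have "norm (S f - result A f) \<le> norm (S f - T f) + norm (T f - result A f)"
    using norm_triangle_ineq[of "S f - T f" "T f - result A f"] by simp
  then have "ennreal (norm (S f - result A f)) \<le> ennreal (norm (S f - T f)) + ennreal (norm (T f - result A f))"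
    by (simp flip: ennreal_plus add: ennreal_leI)
  also have "\<dots> \<le> (SUP f\<in>F. ennreal (norm (S f - T f))) + (SUP f\<in>F. ennreal (norm (T f - result A f)))"
    by (intro add_mono SUP_upper f)
  finally show "ennreal (norm (S f - result A f)) \<le> \<dots>" .
qed

lemma ran_error_perturb:
  fixes S T :: "'f \<Rightarrow> 'g::banach"
  assumes A: "randomized_algorithm F \<Lambda> M A"
  shows "ran_error S F M A \<le> (SUP f\<in>F. ennreal (norm (S f - T f))) + ran_error T F M A"
  unfolding ran_error_def
proof (rule SUP_least)
  fix f assume f: "f \<in> F"
  interpret prob_space M using A by (simp add: randomized_algorithm_def)
  have res: "(\<lambda>\<omega>. result (A \<omega>) f) \<in> borel_measurable M"
    using A f by (simp add: randomized_algorithm_def)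
  have "norm (S f - r) \<le> norm (S f - T f) + norm (T f - r)" for r
    using norm_triangle_ineq[of "S f - T f" "T f - r"] by simp
  then have "(\<integral>\<^sup>+\<omega>. ennreal (norm (S f - result (A \<omega>) f)) \<partial>M)
      \<le> (\<integral>\<^sup>+\<omega>. ennreal (norm (S f - T f)) + ennreal (norm (T f - result (A \<omega>) f)) \<partial>M)"
    by (intro nn_integral_mono) (simp flip: ennreal_plus add: ennreal_leI)
  also have "\<dots> = ennreal (norm (S f - T f)) + (\<integral>\<^sup>+\<omega>. ennreal (norm (T f - result (A \<omega>) f)) \<partial>M)"
    by (subst nn_integral_add[OF _ borel_measurable_error[OF res]]) (simp_all add: emeasure_space_1)
  also have "\<dots> \<le> (SUP f\<in>F. ennreal (norm (S f - T f)))
      + (SUP f\<in>F. \<integral>\<^sup>+\<omega>. ennreal (norm (T f - result (A \<omega>) f)) \<partial>M)"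
    by (intro add_mono SUP_upper f)
  finally show "(\<integral>\<^sup>+\<omega>. ennreal (norm (S f - result (A \<omega>) f)) \<partial>M) \<le> \<dots>" .
qed

text \<open>An algorithm for \<open>T\<close> is also an algorithm for \<open>S\<close>, at the same cost.\<close>
lemma min_error_perturb:
  fixes S T :: "'f \<Rightarrow> 'g::banach" and \<Lambda> :: "('f \<Rightarrow> 'k) set"
  shows "min_error s n S F \<Lambda> \<le> (SUP f\<in>F. ennreal (norm (S f - T f))) + min_error s n T F \<Lambda>"
    (is "?e \<le> ?d + _")
proof -
  have shift: "c \<le> ?d + Inf Q" if "\<And>b. b \<in> Q \<Longrightarrow> c \<le> ?d + b" for c Q
    using le_add_Inf_ennreal[of "{?d}" Q c] that by simp
  show ?thesis
  proof (cases s)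
    case Det
    show ?thesis unfolding Det min_error.simps(1)[of n T]
    proof (rule shift, clarify)
      fix A :: "('f, 'k, 'g) algorithm"
      assume "A \<in> algorithms \<Lambda>" "det_cost F A \<le> enat n"
      from min_error_Det_le[OF this] det_error_perturb
      show "min_error Det n S F \<Lambda> \<le> ?d + det_error T F A" by (rule order_trans)
    qed
  next
    case DetNon
    show ?thesis unfolding DetNon min_error.simps(2)[of n T]
    proof (rule shift, clarify)
      fix A :: "('f, 'k, 'g) algorithm"
      assume "A \<in> algorithms \<Lambda>" "non_adaptive A" "det_cost F A \<le> enat n"
      from min_error_DetNon_le[OF this] det_error_perturb
      show "min_error DetNon n S F \<Lambda> \<le> ?d + det_error T F A" by (rule order_trans)
    qed
  next
    case Ran
    show ?thesis unfolding Ran min_error.simps(3)[of n T]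
    proof (rule shift, clarify)
      fix M :: "('f, 'k, 'g) algorithm measure"
        and A :: "('f, 'k, 'g) algorithm \<Rightarrow> ('f, 'k, 'g) algorithm"
      assume A: "randomized_algorithm F \<Lambda> M A" "ran_cost F M A \<le> of_nat n"
      from min_error_Ran_le[OF A] ran_error_perturb[OF A(1)]
      show "min_error Ran n S F \<Lambda> \<le> ?d + ran_error T F M A" by (rule order_trans)
    qed
  next
    case RanNon
    show ?thesis unfolding RanNon min_error.simps(4)[of n T]
    proof (rule shift, clarify)
      fix M :: "('f, 'k, 'g) algorithm measure"
        and A :: "('f, 'k, 'g) algorithm \<Rightarrow> ('f, 'k, 'g) algorithm"
      assume A: "randomized_algorithm F \<Lambda> M A" "\<forall>\<omega>\<in>space M. non_adaptive (A \<omega>)"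
        "ran_cost F M A \<le> of_nat n"
      from min_error_RanNon_le[OF A] ran_error_perturb[OF A(1)]
      show "min_error RanNon n S F \<Lambda> \<le> ?d + ran_error T F M A" by (rule order_trans)
    qed
  qed
qed

section \<open>Sequence norms and Hoelder's inequality\<close>

lemma ennpowr_0 [simp]: "ennpowr 0 r = 0"
  by (simp add: ennpowr_def)

lemma ennpowr_1 [simp]: "ennpowr 1 r = 1"
  by (simp add: ennpowr_def)

lemma ennpowr_by_1 [simp]: "ennpowr a 1 = a"
  by (cases a) (auto simp: ennpowr_def)

lemma ennpowr_eq_top_iff [simp]: "ennpowr a r = \<top> \<longleftrightarrow> a = \<top>"
  by (simp add: ennpowr_def)

lemma ennpowr_ennreal: "0 \<le> a \<Longrightarrow> ennpowr (ennreal a) r = ennreal (a powr r)"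
  by (simp add: ennpowr_def)

lemma ennpowr_mono: "a \<le> b \<Longrightarrow> 0 \<le> r \<Longrightarrow> ennpowr a r \<le> ennpowr b r"
  by (cases a; cases b) (auto simp: ennpowr_def top_unique intro!: ennreal_leI powr_mono2)

lemma ennpowr_root_ennpowr: "r \<noteq> 0 \<Longrightarrow> ennpowr (ennpowr a r) (1 / r) = a"
  by (cases a) (auto simp: ennpowr_def powr_powr)

lemma ennpowr_ennpowr_root: "r \<noteq> 0 \<Longrightarrow> ennpowr (ennpowr a (1 / r)) r = a"
  using ennpowr_root_ennpowr[of "1 / r" a] by simp

lemma ennpowr_add_le:
  assumes "0 \<le> r"
  shows "ennpowr (a + b) r \<le> ennreal (2 powr r) * (ennpowr a r + ennpowr b r)"
proof (cases "a = \<top> \<or> b = \<top>")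
  case True
  then show ?thesis by (auto simp: ennpowr_def ennreal_mult_top)
next
  case False
  then obtain x y where xy: "a = ennreal x" "b = ennreal y" "0 \<le> x" "0 \<le> y"
    by (metis ennreal_cases)
  have "(x + y) powr r \<le> (2 * max x y) powr r"
    using xy assms by (intro powr_mono2) auto
  also have "\<dots> = 2 powr r * max x y powr r"
    using xy by (simp add: powr_mult)
  also have "\<dots> \<le> 2 powr r * (x powr r + y powr r)"
    by (intro mult_left_mono) (auto simp: max_def)
  finally have "ennreal ((x + y) powr r) \<le> ennreal (2 powr r * (x powr r + y powr r))"
    by (rule ennreal_leI)
  moreover have "a + b = ennreal (x + y)" using xy by simp
  ultimately show ?thesis
    using xy by (simp add: ennpowr_ennreal ennreal_mult del: ennreal_plus) (simp add: ennpowr_ennreal)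
qed

lemma enn2real_ge_1: "1 \<le> p \<Longrightarrow> p \<noteq> \<top> \<Longrightarrow> 1 \<le> enn2real p"
  by (cases p) auto

lemma lp_norm_mono:
  assumes "\<And>k. a k \<le> b k"
  shows "lp_norm p a \<le> lp_norm p b"
  unfolding lp_norm_def using assms
  by (auto intro!: SUP_mono ennpowr_mono suminf_le intro: exI)

lemma lp_norm_single:
  assumes "1 \<le> p"
  shows "lp_norm p (\<lambda>l. if l = k then c else 0) = c"
proof (cases "p = \<top>")
  case True
  have "(SUP l. if l = k then c else 0) = c"
    by (rule antisym) (auto intro!: SUP_least intro: SUP_upper2[of k])
  with True show ?thesis by (simp add: lp_norm_def)
next
  case False
  have "(\<Sum>l. ennpowr (if l = k then c else 0) r) = ennpowr c r" for r
    using suminf_finite[of "{k}" "\<lambda>l. ennpowr (if l = k then c else 0) r"] by simp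
  with False enn2real_ge_1[OF assms False] show ?thesis
    by (simp add: lp_norm_def ennpowr_root_ennpowr)
qed

lemma component_le_lp_norm:
  assumes "1 \<le> p"
  shows "a k \<le> lp_norm p a"
proof -
  have "a k = lp_norm p (\<lambda>l. if l = k then a k else 0)"
    by (simp add: lp_norm_single[OF assms])
  also have "\<dots> \<le> lp_norm p a" by (rule lp_norm_mono) simp
  finally show ?thesis .
qed

text \<open>Minkowski's inequality without its sharp constant: only finiteness is needed to see that a
  direct sum is closed under addition, and for that \<open>(x + y) powr r \<le> 2 powr r * (x powr r + y powr r)\<close>
  suffices.\<close>
lemma lp_norm_add_finite:
  assumes "1 \<le> p" "lp_norm p a < \<top>" "lp_norm p b < \<top>"
  shows "lp_norm p (\<lambda>k. a k + b k) < \<top>"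
proof (cases "p = \<top>")
  case True
  have "(SUP k. a k + b k) \<le> (SUP k. a k) + (SUP k. b k)"
    by (intro SUP_least add_mono SUP_upper) simp_all
  also have "\<dots> < \<top>" using True assms(2,3) by (simp add: lp_norm_def)
  finally show ?thesis using True by (simp add: lp_norm_def)
next
  case False
  define r where "r = enn2real p"
  have r: "0 \<le> r" using enn2real_ge_1[OF assms(1) False] by (simp add: r_def)
  have "(\<Sum>k. ennpowr (a k + b k) r) \<le> (\<Sum>k. ennreal (2 powr r) * (ennpowr (a k) r + ennpowr (b k) r))"
    by (intro suminf_le ennpowr_add_le r) auto
  also have "\<dots> = ennreal (2 powr r) * ((\<Sum>k. ennpowr (a k) r) + (\<Sum>k. ennpowr (b k) r))"
    by (simp add: suminf_add[symmetric])
  also have "\<dots> < \<top>"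
    using assms(2,3) False by (auto simp: lp_norm_def r_def less_top[symmetric] ennreal_mult_eq_top_iff)
  finally show ?thesis using False by (simp add: lp_norm_def r_def less_top[symmetric])
qed

lemma eq_ennreal_if_inverse_eq:
  assumes "0 < t" "1 / q = ennreal (1 / t)"
  shows "q = ennreal t"
proof (cases q)
  case (real u)
  have "u \<noteq> 0"
  proof
    assume "u = 0"
    then have "1 / q = \<top>" using real by (simp add: divide_ennreal_def)
    with assms(2) show False by simp
  qed
  then have "1 / q = ennreal (1 / u)"
    using real divide_ennreal[of 1 u] by simp
  then have "1 / u = 1 / t"
    using assms real by simp
  then show ?thesis using real by simp
next
  case top
  then show ?thesis
    using assms by (simp add: divide_ennreal_def ennreal_eq_0_iff)
qed

text \<open>For \<open>1 < p < \<top>\<close> both sequences are normalized and Young's inequality is summed over \<open>k\<close>; the two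
  resulting sums contribute at most \<open>1 / t\<close> and \<open>1 / r\<close>, which add up to \<open>1\<close>.  The endpoints of the
  range of \<open>p\<close> are estimates by a supremum.\<close>
lemma Hoelder_unit:
  assumes "1 \<le> p" "1 / q = 1 - 1 / p" "lp_norm p b \<le> 1"
  shows "(\<Sum>k. a k * b k) \<le> lp_norm q a"
proof -
  have b1: "b k \<le> 1" for k
    using component_le_lp_norm[OF assms(1), of b k] assms(3) by (rule order_trans)
  consider "p = \<top>" | "p = 1" | "1 < p" "p \<noteq> \<top>"
    using assms(1) by (auto simp: le_less)
  then show ?thesis
  proof cases
    case 1
    then have "1 / q = 1" using assms(2) by simp
    then have "q = 1" using eq_ennreal_if_inverse_eq[of 1 q] by simp
    then have "lp_norm q a = (\<Sum>k. a k)" by (simp add: lp_norm_def)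
    moreover have "(\<Sum>k. a k * b k) \<le> (\<Sum>k. a k)"
      using mult_left_mono[OF b1] by (intro suminf_le) auto
    ultimately show ?thesis by simp
  next
    case 2
    then have "1 / q = 0" using assms(2) by simp
    then have "q = \<top>" by (auto simp: divide_ennreal_def)
    then have q: "lp_norm q a = (SUP k. a k)" by (simp add: lp_norm_def)
    have "(\<Sum>k. b k) \<le> 1" using assms(3) 2 by (simp add: lp_norm_def)
    have "(\<Sum>k. a k * b k) \<le> (\<Sum>k. (SUP k. a k) * b k)"
      by (intro suminf_le mult_right_mono SUP_upper) auto
    also have "\<dots> \<le> (SUP k. a k) * 1"
      using \<open>(\<Sum>k. b k) \<le> 1\<close> by (simp only: ennreal_suminf_cmult) (intro mult_left_mono, auto)
    finally show ?thesis by (simp add: q)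
  next
    case 3
    define r where "r = enn2real p"
    \<comment> \<open>The real value of \<open>q\<close>.\<close>
    define t where "t = r / (r - 1)"
    have r: "1 < r" "p = ennreal r"
      using 3 by (cases p; auto simp: r_def)+
    have t: "1 < t" "1 / t + 1 / r = 1" using r(1) by (auto simp: t_def field_simps)
    have "1 / q = ennreal (1 / t)"
    proof -
      have "1 / p = ennreal (1 / r)" using r by (simp add: divide_ennreal flip: ennreal_1)
      then have "1 / q = ennreal (1 - 1 / r)"
        using assms(2) r(1) by (simp flip: ennreal_1 add: ennreal_minus)
      also have "1 - 1 / r = 1 / t" using t(2) by simp
      finally show ?thesis .
    qed
    then have q: "q = ennreal t" by (rule eq_ennreal_if_inverse_eq[rotated]) (use t(1) in linarith)
    define N where "N = lp_norm q a"
    have N: "N = ennpowr (\<Sum>k. ennpowr (a k) t) (1 / t)"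
      using t(1) by (simp add: N_def lp_norm_def q)
    have sumb: "(\<Sum>k. ennpowr (b k) r) \<le> 1"
    proof -
      have "ennpowr (\<Sum>k. ennpowr (b k) r) (1 / r) \<le> 1" using assms(3) 3 by (simp add: lp_norm_def r_def)
      from ennpowr_mono[OF this, of r] r(1) show ?thesis by (simp add: ennpowr_ennpowr_root)
    qed
    have aN: "a k \<le> N" for k
      unfolding N_def using t(1) by (intro component_le_lp_norm) (simp add: q)
    consider "N = \<top>" | "N = 0" | c where "N = ennreal c" "0 < c"
      by (cases N) force+
    then have "(\<Sum>k. a k * b k) \<le> N"
    proof cases
      case 2
      then have "a k = 0" for k using aN[of k] by simp
      then show ?thesis by simp
    next
      case 3
      have suma: "(\<Sum>k. ennpowr (a k) t) = ennreal (c powr t)"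
        using arg_cong[OF N, of "\<lambda>x. ennpowr x t"] 3 t(1)
        by (simp add: ennpowr_ennpowr_root ennpowr_ennreal)
      \<comment> \<open>Young's inequality for \<open>x / c\<close> and \<open>y\<close>, multiplied by \<open>c\<close>, has these coefficients.\<close>
      define u v where "u = c / t / c powr t" and "v = c / r"
      have uv: "0 \<le> u" "0 \<le> v" using t(1) r(1) 3(2) by (auto simp: u_def v_def)
      have "a k * b k \<le> ennreal u * ennpowr (a k) t + ennreal v * ennpowr (b k) r" for k
      proof -
        obtain x where x: "a k = ennreal x" "0 \<le> x" using aN[of k] 3 by (cases "a k") (auto simp: top_unique)
        obtain y where y: "b k = ennreal y" "0 \<le> y" using b1[of k] by (cases "b k") (auto simp: top_unique)
        have "(x / c) * y \<le> (x / c) powr t / t + y powr r / r"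
          using t r x y 3(2) by (intro Youngs_inequality) auto
        then have "c * ((x / c) * y) \<le> c * ((x / c) powr t / t + y powr r / r)"
          using 3(2) by (intro mult_left_mono) auto
        then have "x * y \<le> u * x powr t + v * y powr r"
          using x 3(2) by (simp add: powr_divide field_simps u_def v_def)
        then have "ennreal (x * y) \<le> ennreal (u * x powr t + v * y powr r)"
          by (rule ennreal_leI)
        then show ?thesis
          using x y uv by (simp add: ennpowr_ennreal ennreal_mult)
      qed
      then have "(\<Sum>k. a k * b k) \<le> (\<Sum>k. ennreal u * ennpowr (a k) t + ennreal v * ennpowr (b k) r)"
        by (intro suminf_le) auto
      also have "\<dots> = ennreal u * ennreal (c powr t) + ennreal v * (\<Sum>k. ennpowr (b k) r)"
        by (simp add: suma suminf_add[symmetric])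
      also have "\<dots> \<le> ennreal u * ennreal (c powr t) + ennreal v * 1"
        by (intro add_left_mono mult_left_mono sumb) simp
      also have "\<dots> = ennreal (u * c powr t + v)"
        using uv by (simp add: ennreal_mult)
      also have "u * c powr t + v = c * (1 / t + 1 / r)"
        using 3(2) by (simp add: field_simps u_def v_def)
      also have "ennreal \<dots> = N" unfolding t(2) 3(1) by simp
      finally show ?thesis .
    qed simp
    then show ?thesis by (simp add: N_def)
  qed
qed

section \<open>Operators on direct sums\<close>

lemma banach_spaceD:
  assumes "banach_space X"
  shows "abelian_group X"
    and "nrm X \<zero>\<^bsub>X\<^esub> = 0"
    and "x \<in> carrier X \<Longrightarrow> 0 \<le> nrm X x"
    and "x \<in> carrier X \<Longrightarrow> c \<odot>\<^bsub>X\<^esub> x \<in> carrier X"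
proof -
  interpret module scalars X using assms by (simp add: banach_space_def)
  show "abelian_group X" by (rule M.abelian_group_axioms)
  show "nrm X \<zero>\<^bsub>X\<^esub> = 0" using assms M.zero_closed unfolding banach_space_def by blast
  show "x \<in> carrier X \<Longrightarrow> 0 \<le> nrm X x" using assms by (simp add: banach_space_def)
  show "x \<in> carrier X \<Longrightarrow> c \<odot>\<^bsub>X\<^esub> x \<in> carrier X" by (rule smult_closed) (simp add: scalars_def)
qed

lemma bounded_ops_zero:
  assumes "banach_space X" "T \<in> bounded_ops X sc"
  shows "T \<zero>\<^bsub>X\<^esub> = 0"
proof -
  interpret abelian_group X by (rule banach_spaceD(1)[OF assms(1)])
  have "T (\<zero>\<^bsub>X\<^esub> \<oplus>\<^bsub>X\<^esub> \<zero>\<^bsub>X\<^esub>) = T \<zero>\<^bsub>X\<^esub> + T \<zero>\<^bsub>X\<^esub>"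
    using assms(2) zero_closed unfolding bounded_ops_def by blast
  then show ?thesis by simp
qed

text \<open>Normalize \<open>x\<close> by the scalar \<open>1 / nrm X x\<close>, an element of \<open>'k\<close> as the image of a real number.\<close>
lemma norm_le_op_norm:
  fixes X :: "('k::real_or_complex, 'a) normed_module"
  assumes X: "banach_space X" and sc: "scalar_multiplication sc"
    and T: "T \<in> bounded_ops X sc" and x: "x \<in> carrier X"
  shows "ennreal (norm (T x)) \<le> op_norm X T * ennreal (nrm X x)"
proof (cases "nrm X x = 0")
  case True
  then have "x = \<zero>\<^bsub>X\<^esub>" using X x by (simp add: banach_space_def)
  then show ?thesis by (simp add: bounded_ops_zero[OF X T])
next
  case False
  define r where "r = nrm X x"
  have r: "0 < r" using False banach_spaceD(3)[OF X x] by (simp add: r_def)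
  define c :: 'k where "c = of_real (inverse r)"
  have c: "norm c = inverse r" unfolding c_def norm_of_real using r by simp
  have "nrm X (c \<odot>\<^bsub>X\<^esub> x) = norm c * nrm X x"
    using X x by (simp add: banach_space_def)
  then have "c \<odot>\<^bsub>X\<^esub> x \<in> unit_ball X"
    using banach_spaceD(4)[OF X x, of c] r unfolding c by (simp add: unit_ball_def r_def)
  then have "ennreal (norm (T (c \<odot>\<^bsub>X\<^esub> x))) \<le> op_norm X T"
    unfolding op_norm_def by (rule SUP_upper)
  also have "norm (T (c \<odot>\<^bsub>X\<^esub> x)) = inverse r * norm (T x)"
    using T x sc by (simp add: bounded_ops_def scalar_multiplication_def c)
  finally have "ennreal (inverse r * norm (T x)) * ennreal r \<le> op_norm X T * ennreal r"
    by (rule mult_right_mono) simp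
  also have "ennreal (inverse r * norm (T x)) * ennreal r = ennreal (norm (T x))"
    using r by (simp flip: ennreal_mult'')
  finally show ?thesis by (simp add: r_def)
qed

lemma direct_sum_simps:
  "carrier (direct_sum p X) =
    {x. (\<forall>k. x k \<in> carrier (X k)) \<and> lp_norm p (\<lambda>k. ennreal (nrm (X k) (x k))) < \<top>}"
  "\<zero>\<^bsub>direct_sum p X\<^esub> = (\<lambda>k. \<zero>\<^bsub>X k\<^esub>)"
  "x \<oplus>\<^bsub>direct_sum p X\<^esub> y = (\<lambda>k. x k \<oplus>\<^bsub>X k\<^esub> y k)"
  "nrm (direct_sum p X) x = enn2real (lp_norm p (\<lambda>k. ennreal (nrm (X k) (x k))))"
  by (simp_all add: direct_sum_def)

lemma unit_ball_direct_sum: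
  "unit_ball (direct_sum p X) =
    {x. (\<forall>k. x k \<in> carrier (X k)) \<and> lp_norm p (\<lambda>k. ennreal (nrm (X k) (x k))) \<le> 1}"
proof -
  have "(a < \<top> \<and> enn2real a \<le> 1) \<longleftrightarrow> a \<le> 1" for a :: ennreal
    by (cases a) (auto simp: top_unique)
  then show ?thesis by (auto simp: unit_ball_def direct_sum_simps)
qed

lemma component_in_unit_ball:
  assumes "1 \<le> p" "x \<in> unit_ball (direct_sum p X)"
  shows "x k \<in> unit_ball (X k)"
proof -
  have "ennreal (nrm (X k) (x k)) \<le> lp_norm p (\<lambda>k. ennreal (nrm (X k) (x k)))"
    by (rule component_le_lp_norm[OF assms(1)])
  also have "\<dots> \<le> 1" using assms(2) by (simp add: unit_ball_direct_sum)
  finally have "nrm (X k) (x k) \<le> 1" by simp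
  moreover have "x k \<in> carrier (X k)" using assms(2) by (simp add: unit_ball_direct_sum)
  ultimately show ?thesis by (simp add: unit_ball_def)
qed

lemma single_in_unit_ball:
  assumes "1 \<le> p" "\<And>k. banach_space (X k)" "u \<in> unit_ball (X k)"
  shows "(\<lambda>l. if l = k then u else \<zero>\<^bsub>X l\<^esub>) \<in> unit_ball (direct_sum p X)"
proof -
  interpret abelian_group "X l" for l by (rule banach_spaceD(1)[OF assms(2)])
  have "(\<lambda>l. ennreal (nrm (X l) (if l = k then u else \<zero>\<^bsub>X l\<^esub>)))
      = (\<lambda>l. if l = k then ennreal (nrm (X k) u) else 0)"
    by (auto simp: banach_spaceD(2)[OF assms(2)])
  moreover have "u \<in> carrier (X k)" "nrm (X k) u \<le> 1"
    using assms(3) by (auto simp: unit_ball_def)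
  ultimately show ?thesis
    unfolding unit_ball_direct_sum using zero_closed by (auto simp: lp_norm_single[OF assms(1)])
qed

text \<open>The finite sum of the coordinate projections in the theorem is formed in the direct sum itself
  and only has meaning there because of this structure.\<close>
lemma abelian_monoid_direct_sum:
  assumes "1 \<le> p" "\<And>k. banach_space (X k)"
  shows "abelian_monoid (direct_sum p X)"
proof (rule abelian_monoidI)
  interpret abelian_group "X l" for l by (rule banach_spaceD(1)[OF assms(2)])
  fix x y assume x: "x \<in> carrier (direct_sum p X)" and y: "y \<in> carrier (direct_sum p X)"
  have "lp_norm p (\<lambda>k. ennreal (nrm (X k) (x k \<oplus>\<^bsub>X k\<^esub> y k)))
      \<le> lp_norm p (\<lambda>k. ennreal (nrm (X k) (x k)) + ennreal (nrm (X k) (y k)))"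
  proof (rule lp_norm_mono)
    fix k
    have xy: "x k \<in> carrier (X k)" "y k \<in> carrier (X k)"
      using x y by (auto simp: direct_sum_simps)
    then have "nrm (X k) (x k \<oplus>\<^bsub>X k\<^esub> y k) \<le> nrm (X k) (x k) + nrm (X k) (y k)"
      using assms(2)[of k] by (simp add: banach_space_def)
    then show "ennreal (nrm (X k) (x k \<oplus>\<^bsub>X k\<^esub> y k))
        \<le> ennreal (nrm (X k) (x k)) + ennreal (nrm (X k) (y k))"
      using banach_spaceD(3)[OF assms(2)] xy by (simp add: ennreal_leI flip: ennreal_plus)
  qed
  also have "\<dots> < \<top>"
    using x y by (intro lp_norm_add_finite assms(1)) (auto simp: direct_sum_simps)
  finally show "x \<oplus>\<^bsub>direct_sum p X\<^esub> y \<in> carrier (direct_sum p X)"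
    using x y by (simp add: direct_sum_simps)
  show "x \<oplus>\<^bsub>direct_sum p X\<^esub> y = y \<oplus>\<^bsub>direct_sum p X\<^esub> x"
    using x y by (auto simp: direct_sum_simps a_comm)
  show "\<zero>\<^bsub>direct_sum p X\<^esub> \<oplus>\<^bsub>direct_sum p X\<^esub> x = x"
    using x by (auto simp: direct_sum_simps)
  fix z assume "z \<in> carrier (direct_sum p X)"
  then show "x \<oplus>\<^bsub>direct_sum p X\<^esub> y \<oplus>\<^bsub>direct_sum p X\<^esub> z = x \<oplus>\<^bsub>direct_sum p X\<^esub> (y \<oplus>\<^bsub>direct_sum p X\<^esub> z)"
    using x y by (auto simp: direct_sum_simps a_assoc)
next
  interpret abelian_group "X l" for l by (rule banach_spaceD(1)[OF assms(2)])
  show "\<zero>\<^bsub>direct_sum p X\<^esub> \<in> carrier (direct_sum p X)"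
    using lp_norm_single[OF assms(1), of 0 0]
    by (simp add: direct_sum_simps banach_spaceD(2)[OF assms(2)])
qed

lemma finsum_coord_proj:
  fixes X :: "nat \<Rightarrow> ('k::real_or_complex, 'a) normed_module"
  assumes "1 \<le> p" "\<And>k. banach_space (X k)" "x \<in> carrier (direct_sum p X)"
  shows "(\<Oplus>\<^bsub>direct_sum p X\<^esub>k\<in>{..K}. coord_proj X k x) = (\<lambda>l. if l \<le> K then x l else \<zero>\<^bsub>X l\<^esub>)"
proof -
  interpret abelian_group "X l" for l by (rule banach_spaceD(1)[OF assms(2)])
  interpret D: abelian_monoid "direct_sum p X" by (rule abelian_monoid_direct_sum[OF assms(1,2)])
  have x: "x l \<in> carrier (X l)" for l using assms(3) by (simp add: direct_sum_simps)
  have proj: "coord_proj X k x \<in> carrier (direct_sum p X)" for k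
  proof -
    have "(\<lambda>l. ennreal (nrm (X l) (if l = k then x k else \<zero>\<^bsub>X l\<^esub>)))
        = (\<lambda>l. if l = k then ennreal (nrm (X k) (x k)) else 0)"
      by (auto simp: banach_spaceD(2)[OF assms(2)])
    then show ?thesis
      using x by (auto simp: direct_sum_simps coord_proj_def lp_norm_single[OF assms(1)])
  qed
  show ?thesis
  proof (induction K)
    case 0
    have "(\<Oplus>\<^bsub>direct_sum p X\<^esub>k\<in>{..0}. coord_proj X k x) = coord_proj X 0 x"
      using proj by (subst D.finsum_0) auto
    then show ?case by (auto simp: coord_proj_def)
  next
    case (Suc K)
    have "(\<Oplus>\<^bsub>direct_sum p X\<^esub>k\<in>{..Suc K}. coord_proj X k x)
        = coord_proj X (Suc K) x \<oplus>\<^bsub>direct_sum p X\<^esub> (\<Oplus>\<^bsub>direct_sum p X\<^esub>k\<in>{..K}. coord_proj X k x)"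
      using proj by (subst D.finsum_Suc) auto
    also have "\<dots> = (\<lambda>l. if l \<le> Suc K then x l else \<zero>\<^bsub>X l\<^esub>)"
      unfolding Suc unfolding direct_sum_simps coord_proj_def using x by (auto simp: le_Suc_eq)
    finally show ?case .
  qed
qed

lemma sum_operator_truncation:
  assumes "\<And>k. banach_space (X k)" "\<And>k. S k \<in> bounded_ops (X k) sc"
  shows "sum_operator S (\<lambda>l. if l \<le> K then x l else \<zero>\<^bsub>X l\<^esub>) = (\<Sum>k\<le>K. S k (x k))"
proof -
  have "(\<Sum>l. S l (if l \<le> K then x l else \<zero>\<^bsub>X l\<^esub>)) = (\<Sum>l\<le>K. S l (if l \<le> K then x l else \<zero>\<^bsub>X l\<^esub>))"
    by (rule suminf_finite) (auto simp: bounded_ops_zero[OF assms])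
  then show ?thesis by (simp add: sum_operator_def)
qed

lemma sum_operator_single:
  assumes "\<And>k. banach_space (X k)" "\<And>k. S k \<in> bounded_ops (X k) sc"
  shows "sum_operator S (\<lambda>l. if l = k then u else \<zero>\<^bsub>X l\<^esub>) = S k u"
proof -
  have "(\<Sum>l. S l (if l = k then u else \<zero>\<^bsub>X l\<^esub>)) = (\<Sum>l\<in>{k}. S l (if l = k then u else \<zero>\<^bsub>X l\<^esub>))"
    by (rule suminf_finite) (auto simp: bounded_ops_zero[OF assms])
  then show ?thesis by (simp add: sum_operator_def)
qed

lemma sum_norms_le:
  fixes X :: "nat \<Rightarrow> ('k::real_or_complex, 'a) normed_module"
  assumes "1 \<le> p" "1 / q = 1 - 1 / p" "\<And>k. banach_space (X k)" "scalar_multiplication sc"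
    and "\<And>k. S k \<in> bounded_ops (X k) sc" and x: "x \<in> unit_ball (direct_sum p X)"
  shows "(\<Sum>k. ennreal (norm (S k (x k)))) \<le> lp_norm q (\<lambda>k. op_norm (X k) (S k))"
proof -
  have "(\<Sum>k. ennreal (norm (S k (x k)))) \<le> (\<Sum>k. op_norm (X k) (S k) * ennreal (nrm (X k) (x k)))"
    using x by (intro suminf_le norm_le_op_norm[OF assms(3,4,5)]) (auto simp: unit_ball_direct_sum)
  also have "\<dots> \<le> lp_norm q (\<lambda>k. op_norm (X k) (S k))"
    using x by (intro Hoelder_unit[OF assms(1,2)]) (simp add: unit_ball_direct_sum)
  finally show ?thesis .
qed

lemma shift_in_unit_ball:
  assumes "1 \<le> p" "x \<in> unit_ball (direct_sum p X)"
  shows "(\<lambda>j. x (m + j)) \<in> unit_ball (direct_sum p (\<lambda>j. X (m + j)))"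
proof -
  have "lp_norm p (\<lambda>j. a (m + j)) \<le> lp_norm p a" for a
  proof (cases "p = \<top>")
    case True
    then show ?thesis by (auto simp: lp_norm_def intro!: SUP_least SUP_upper)
  next
    case False
    have "(\<Sum>j. f (m + j)) \<le> (\<Sum>k. f k)" for f :: "nat \<Rightarrow> ennreal"
      using suminf_offset[OF summableI, of f m] by (simp add: add.commute[of m])
    then show ?thesis using False by (auto simp: lp_norm_def intro!: ennpowr_mono)
  qed
  from this[of "\<lambda>k. ennreal (nrm (X k) (x k))"] assms(2) show ?thesis
    by (auto simp: unit_ball_direct_sum)
qed

text \<open>Hoelder's inequality for the full sequences makes the series converge absolutely; for the
  sequences shifted by \<open>m\<close>, which again form an element of the unit ball of a direct sum, it bounds
  the remainder.\<close>
lemma norm_tail_le: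
  fixes X :: "nat \<Rightarrow> ('k::real_or_complex, 'a) normed_module" and S :: "nat \<Rightarrow> 'a \<Rightarrow> 'g::banach"
  assumes "1 \<le> p" "1 / q = 1 - 1 / p" "\<And>k. banach_space (X k)" "scalar_multiplication sc"
    and "\<And>k. S k \<in> bounded_ops (X k) sc" and "x \<in> unit_ball (direct_sum p X)"
    and "lp_norm q (\<lambda>k. op_norm (X k) (S k)) < \<top>"
  shows "ennreal (norm (sum_operator S x - (\<Sum>k<m. S k (x k))))
    \<le> lp_norm q (\<lambda>j. op_norm (X (m + j)) (S (m + j)))"
proof -
  have "(\<Sum>k. ennreal (norm (S k (x k)))) < \<top>"
    using sum_norms_le[where X = X, OF assms(1-6)] assms(7) by (rule le_less_trans)
  then have "summable (\<lambda>k. norm (S k (x k)))"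
    by (intro summable_suminf_not_top) auto
  then have s: "summable (\<lambda>k. S k (x k))" and t: "summable (\<lambda>j. norm (S (j + m) (x (j + m))))"
    by (rule summable_norm_cancel, rule summable_ignore_initial_segment)
  have "sum_operator S x - (\<Sum>k<m. S k (x k)) = (\<Sum>j. S (j + m) (x (j + m)))"
    unfolding sum_operator_def suminf_split_initial_segment[OF s, of m]
    by simp
  then have "ennreal (norm (sum_operator S x - (\<Sum>k<m. S k (x k))))
      \<le> ennreal (\<Sum>j. norm (S (j + m) (x (j + m))))"
    using summable_norm[OF t] by (simp add: ennreal_leI)
  also have "\<dots> = (\<Sum>j. ennreal (norm (S (j + m) (x (j + m)))))"
    by (rule suminf_ennreal2[OF _ t, symmetric]) (rule norm_ge_zero)
  also have "\<dots> = (\<Sum>j. ennreal (norm (S (m + j) (x (m + j)))))"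
    by (simp only: add.commute[of m])
  also have "\<dots> \<le> lp_norm q (\<lambda>j. op_norm (X (m + j)) (S (m + j)))"
    by (rule sum_norms_le[OF assms(1,2,3,4,5) shift_in_unit_ball[OF assms(1,6)]])
  finally show ?thesis .
qed

section \<open>Minimal errors of the sum operator\<close>

lemma min_error_coordinate_le:
  assumes "1 \<le> p"
  shows "min_error s n (\<lambda>x. S k (x k)) (unit_ball (direct_sum p X)) (sum_functionals \<Lambda>)
    \<le> min_error s n (S k) (unit_ball (X k)) (\<Lambda> k)"
proof (rule min_error_pullback[where J = "\<lambda>x. x k"])
  show "x k \<in> unit_ball (X k)" if "x \<in> unit_ball (direct_sum p X)" for x
    using assms that by (rule component_in_unit_ball)
  show "\<exists>l'\<in>sum_functionals \<Lambda>. \<exists>\<gamma>. \<forall>x\<in>unit_ball (direct_sum p X). l (x k) = \<gamma> (l' x)"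
    if "l \<in> \<Lambda> k" for l
  proof (rule bexI)
    show "(\<lambda>x. l (x k)) \<in> sum_functionals \<Lambda>"
      using that by (auto simp: sum_functionals_def)
    show "\<exists>\<gamma>. \<forall>x\<in>unit_ball (direct_sum p X). l (x k) = \<gamma> ((\<lambda>x. l (x k)) x)"
      by (intro exI[of _ id]) simp
  qed
qed simp

lemma min_error_partial_sum_le:
  assumes "1 \<le> p"
  shows "min_error s (\<Sum>k\<le>K. m k) (\<lambda>x. \<Sum>k\<le>K. S k (x k)) (unit_ball (direct_sum p X)) (sum_functionals \<Lambda>)
    \<le> (\<Sum>k\<le>K. min_error s (m k) (S k) (unit_ball (X k)) (\<Lambda> k))"
proof (induction K)
  case 0
  show ?case by (simp add: min_error_coordinate_le[OF assms])
next
  case (Suc K)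
  have "min_error s ((\<Sum>k\<le>K. m k) + m (Suc K)) (\<lambda>x. (\<Sum>k\<le>K. S k (x k)) + S (Suc K) (x (Suc K)))
        (unit_ball (direct_sum p X)) (sum_functionals \<Lambda>)
      \<le> min_error s (\<Sum>k\<le>K. m k) (\<lambda>x. \<Sum>k\<le>K. S k (x k)) (unit_ball (direct_sum p X)) (sum_functionals \<Lambda>)
        + min_error s (m (Suc K)) (\<lambda>x. S (Suc K) (x (Suc K))) (unit_ball (direct_sum p X)) (sum_functionals \<Lambda>)"
    by (rule min_error_add)
  also have "\<dots> \<le> (\<Sum>k\<le>K. min_error s (m k) (S k) (unit_ball (X k)) (\<Lambda> k))
        + min_error s (m (Suc K)) (S (Suc K)) (unit_ball (X (Suc K))) (\<Lambda> (Suc K))"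
    by (intro add_mono Suc min_error_coordinate_le[OF assms])
  finally show ?case by simp
qed

lemma min_error_summand_le:
  fixes X :: "nat \<Rightarrow> ('k::real_or_complex, 'a) normed_module"
  assumes "1 \<le> p" "\<And>k. banach_space (X k)" "\<And>k. S k \<in> bounded_ops (X k) sc"
    and "\<Lambda> k \<noteq> {}" and "\<And>j. \<Lambda> j \<subseteq> dual_space (X j)"
  shows "min_error s n (S k) (unit_ball (X k)) (\<Lambda> k)
    \<le> min_error s n (sum_operator S) (unit_ball (direct_sum p X)) (sum_functionals \<Lambda>)"
proof (rule min_error_pullback[where J = "\<lambda>u l. if l = k then u else \<zero>\<^bsub>X l\<^esub>"])
  let ?J = "\<lambda>u l. if l = k then u else \<zero>\<^bsub>X l\<^esub>"
  show "?J u \<in> unit_ball (direct_sum p X)" if "u \<in> unit_ball (X k)" for u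
    using assms(1,2) that by (rule single_in_unit_ball)
  show "S k u = sum_operator S (?J u)" if "u \<in> unit_ball (X k)" for u
    by (rule sum_operator_single[OF assms(2,3), symmetric])
  show "\<exists>l'\<in>\<Lambda> k. \<exists>\<gamma>. \<forall>u\<in>unit_ball (X k). l (?J u) = \<gamma> (l' u)" if "l \<in> sum_functionals \<Lambda>" for l
  proof -
    from that obtain j l\<^sub>j where l: "l = (\<lambda>x. l\<^sub>j (x j))" "l\<^sub>j \<in> \<Lambda> j"
      by (auto simp: sum_functionals_def)
    show ?thesis
    proof (cases "j = k")
      case True
      then have "\<forall>u\<in>unit_ball (X k). l (?J u) = id (l\<^sub>j u)" using l by simp
      then show ?thesis using True l(2) by blast
    next
      case False
      have "l\<^sub>j \<zero>\<^bsub>X j\<^esub> = 0"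
        using assms(2,5) l(2) by (intro bounded_ops_zero) (auto simp: dual_space_def)
      then have "\<forall>u\<in>unit_ball (X k). l (?J u) = 0"
        using l(1) False by simp
      then have "\<exists>\<gamma>. \<forall>u\<in>unit_ball (X k). l (?J u) = \<gamma> (l' u)" for l' :: "'a \<Rightarrow> 'k"
        by (intro exI[of _ "\<lambda>_. 0"])
      then show ?thesis using assms(4) by blast
    qed
  qed
qed

theorem lemma5p1:
  fixes X :: "nat \<Rightarrow> ('k::real_or_complex, 'a) normed_module"
    and scaleG :: "'k \<Rightarrow> 'g::banach \<Rightarrow> 'g"
    and S :: "nat \<Rightarrow> 'a \<Rightarrow> 'g"
    and \<Lambda> :: "nat \<Rightarrow> ('a \<Rightarrow> 'k) set"
    and p q :: ennreal
    and s :: setting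
  assumes "1 \<le> p" and "1 / q = 1 - 1 / p"
    and "\<And>k. banach_space (X k)"
    and "scalar_multiplication scaleG"
    and "\<And>k. S k \<in> bounded_ops (X k) scaleG"
    and "\<And>k. \<Lambda> k \<noteq> {}" and "\<And>k. \<Lambda> k \<subseteq> dual_space (X k)"
    and "lp_norm q (\<lambda>k. op_norm (X k) (S k)) < \<top>"
  shows "(\<forall>n k. min_error s n (S k) (unit_ball (X k)) (\<Lambda> k)
            \<le> min_error s n (sum_operator S) (unit_ball (direct_sum p X)) (sum_functionals \<Lambda>)) \<and>
    (\<forall>k\<^sub>1 (m :: nat \<Rightarrow> nat) n. n = (\<Sum>k\<le>k\<^sub>1. m k) \<longrightarrow>
       min_error s n (sum_operator S) (unit_ball (direct_sum p X)) (sum_functionals \<Lambda>)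
         \<le> op_norm (direct_sum p X)
              (\<lambda>x. sum_operator S x
                 - sum_operator S (\<Oplus>\<^bsub>direct_sum p X\<^esub>k\<in>{..k\<^sub>1}. coord_proj X k x))
            + (\<Sum>k\<le>k\<^sub>1. min_error s (m k) (S k) (unit_ball (X k)) (\<Lambda> k)) \<and>
       op_norm (direct_sum p X)
              (\<lambda>x. sum_operator S x
                 - sum_operator S (\<Oplus>\<^bsub>direct_sum p X\<^esub>k\<in>{..k\<^sub>1}. coord_proj X k x))
            + (\<Sum>k\<le>k\<^sub>1. min_error s (m k) (S k) (unit_ball (X k)) (\<Lambda> k))
         \<le> lp_norm q (\<lambda>j. op_norm (X (k\<^sub>1 + 1 + j)) (S (k\<^sub>1 + 1 + j)))
            + (\<Sum>k\<le>k\<^sub>1. min_error s (m k) (S k) (unit_ball (X k)) (\<Lambda> k)))"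
proof -
  let ?B = "unit_ball (direct_sum p X)" and ?L = "sum_functionals \<Lambda>"
  let ?D = "\<lambda>K. op_norm (direct_sum p X) (\<lambda>x. sum_operator S x
      - sum_operator S (\<Oplus>\<^bsub>direct_sum p X\<^esub>k\<in>{..K}. coord_proj X k x))"
  let ?E = "\<lambda>K m. \<Sum>k\<le>K. min_error s (m k) (S k) (unit_ball (X k)) (\<Lambda> k)"
  have D: "?D K = (SUP x\<in>?B. ennreal (norm (sum_operator S x - (\<Sum>k\<le>K. S k (x k)))))" for K
  proof -
    have "sum_operator S (\<Oplus>\<^bsub>direct_sum p X\<^esub>k\<in>{..K}. coord_proj X k x) = (\<Sum>k\<le>K. S k (x k))"
      if "x \<in> ?B" for x
    proof -
      have "x \<in> carrier (direct_sum p X)" using that by (simp add: unit_ball_def)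
      from finsum_coord_proj[OF assms(1,3) this] show ?thesis
        using sum_operator_truncation[OF assms(3,5)] by simp
    qed
    then show ?thesis
      unfolding op_norm_def by (intro SUP_cong) simp_all
  qed
  have "min_error s n (S k) (unit_ball (X k)) (\<Lambda> k) \<le> min_error s n (sum_operator S) ?B ?L" for n k
    by (rule min_error_summand_le[OF assms(1,3,5,6,7)])
  moreover have "min_error s n (sum_operator S) ?B ?L \<le> ?D K + ?E K m"
    if n: "n = (\<Sum>k\<le>K. m k)" for K m n
  proof -
    have "min_error s n (sum_operator S) ?B ?L
        \<le> ?D K + min_error s n (\<lambda>x. \<Sum>k\<le>K. S k (x k)) ?B ?L"
      unfolding D by (rule min_error_perturb)
    also have "\<dots> \<le> ?D K + ?E K m"
      unfolding n by (intro add_left_mono min_error_partial_sum_le[OF assms(1)])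
    finally show ?thesis .
  qed
  moreover have "?D K \<le> lp_norm q (\<lambda>j. op_norm (X (K + 1 + j)) (S (K + 1 + j)))" for K
    unfolding D
  proof (rule SUP_least)
    fix x assume "x \<in> ?B"
    from norm_tail_le[where X = X and m = "K + 1", OF assms(1-5) this assms(8)]
    show "ennreal (norm (sum_operator S x - (\<Sum>k\<le>K. S k (x k))))
        \<le> lp_norm q (\<lambda>j. op_norm (X (K + 1 + j)) (S (K + 1 + j)))"
      by (simp only: Suc_eq_plus1[symmetric] lessThan_Suc_atMost)
  qed
  ultimately show ?thesis by (blast intro: add_right_mono)
qed

end
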